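(* Let $G=H\oplus K$ with $H,K$ finite abelian groups, let $E_1\subseteq H$ be nonempty and $E=E_1\times K\subseteq G$. Then for each normalized tightness quantity $\widetilde Q\in\{\widetilde L,\widetilde U,\widetilde\rho,\widetilde D\}$ we have $\widetilde Q(E)=\widetilde Q(E_1)$. In particular $\rho(E_1\times K)=\rho(E_1)$, and $E_1$ is spectral (in $H$) if and only if $E_1\times K$ is spectral (in $G$).
   Context: For a finite abelian group $\Gamma$ with dual $\widehat\Gamma$ (characters $\Gamma\to\mathbb{S}^1$), nonempty $E=\{x_1,\dots,x_n\}\subseteq\Gamma$ and $B=\{b_1,\dots,b_n\}\subseteq\widehat\Gamma$, let $T(E,B)$ be the $n\times n$ matrix with $(i,j)$ entry $b_j(x_i)$. Let $L_E(B)=\sigma_{\min}(T)^2$, $U_E(B)=\|T\|^2$ (operator $2$-norm), $\rho_E(B)=U_E(B)/L_E(B)$, $D_E(B)=|\det T|$. Normalized quantities: $\widetilde L_E(B)=n/L_E(B)$, $\widetilde U_E(B)=U_E(B)/n$, $\widetilde\rho_E(B)=\rho_E(B)$, $\widetilde D_E(B)=\sqrt n/D_E(B)^{1/n}$ (each $\infty$ when $T$ is singular, where applicable). For a set, $\widetilde Q(E)=\min_B\widetilde Q_E(B)$ over $B\subseteq\widehat\Gamma$ with $|B|=|E|$. $E$ is spectral if some such $B$ has pairwise orthogonal columns of $T(E,B)$ (equivalently $\widetilde Q(E)=1$). Here $\widetilde Q(E_1)$ is computed with $\Gamma=H$ and $\widetilde Q(E)$ with $\Gamma=G$. *)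

theory Defs
  imports
    "Jordan_Normal_Form.Schur_Decomposition"
    "HOL-Library.Extended_Real"
    "HOL-Library.Product_Plus"
begin

definition dual :: "('g :: {finite, ab_group_add} \<Rightarrow> complex) set" where
  "dual = {\<chi>. (\<forall>x y. \<chi> (x + y) = \<chi> x * \<chi> y) \<and> (\<forall>x. cmod (\<chi> x) = 1)}"

text \<open>The matrix \<open>T(E,B)\<close> depends on how \<open>E\<close> and \<open>B\<close> are enumerated, but only up to a
  permutation of its rows and columns. None of the quantities below is affected by that, so
  an arbitrary enumeration is fixed for each finite set.\<close>

definition enumeration :: "'a set \<Rightarrow> 'a list" where
  "enumeration A = (SOME xs. distinct xs \<and> set xs = A)"

definition char_mat :: "'g set \<Rightarrow> ('g \<Rightarrow> complex) set \<Rightarrow> complex mat" where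
  "char_mat E B =
     mat (card E) (card B) (\<lambda>(i, j). (enumeration B ! j) (enumeration E ! i))"

definition vec_norm2 :: "complex vec \<Rightarrow> real" where
  "vec_norm2 v = sqrt (\<Sum>i<dim_vec v. (cmod (v $ i))\<^sup>2)"

definition op_norm2 :: "complex mat \<Rightarrow> real" where
  "op_norm2 A = (SUP v\<in>{v \<in> carrier_vec (dim_col A). vec_norm2 v = 1}. vec_norm2 (A *\<^sub>v v))"

definition singular_values :: "complex mat \<Rightarrow> real set" where
  "singular_values A =
     {s. s \<ge> 0 \<and> eigenvalue (mat_adjoint A * A) (complex_of_real (s\<^sup>2))}"

definition sigma_min :: "complex mat \<Rightarrow> real" where
  "sigma_min A = Min (singular_values A)"

definition L_EB :: "'g set \<Rightarrow> ('g \<Rightarrow> complex) set \<Rightarrow> real" where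
  "L_EB E B = (sigma_min (char_mat E B))\<^sup>2"

definition U_EB :: "'g set \<Rightarrow> ('g \<Rightarrow> complex) set \<Rightarrow> real" where
  "U_EB E B = (op_norm2 (char_mat E B))\<^sup>2"

definition rho_EB :: "'g set \<Rightarrow> ('g \<Rightarrow> complex) set \<Rightarrow> ereal" where
  "rho_EB E B = (if det (char_mat E B) = 0 then \<infinity> else ereal (U_EB E B / L_EB E B))"

definition D_EB :: "'g set \<Rightarrow> ('g \<Rightarrow> complex) set \<Rightarrow> real" where
  "D_EB E B = cmod (det (char_mat E B))"

definition norm_L_EB :: "'g set \<Rightarrow> ('g \<Rightarrow> complex) set \<Rightarrow> ereal" where
  "norm_L_EB E B =
     (if det (char_mat E B) = 0 then \<infinity> else ereal (real (card E) / L_EB E B))"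

text \<open>Unlike the other three quantities, this one stays finite when \<open>T(E,B)\<close> is singular.\<close>

definition norm_U_EB :: "'g set \<Rightarrow> ('g \<Rightarrow> complex) set \<Rightarrow> ereal" where
  "norm_U_EB E B = ereal (U_EB E B / real (card E))"

definition norm_rho_EB :: "'g set \<Rightarrow> ('g \<Rightarrow> complex) set \<Rightarrow> ereal" where
  "norm_rho_EB E B = rho_EB E B"

definition norm_D_EB :: "'g set \<Rightarrow> ('g \<Rightarrow> complex) set \<Rightarrow> ereal" where
  "norm_D_EB E B =
     (if det (char_mat E B) = 0 then \<infinity>
      else ereal (sqrt (real (card E)) / root (card E) (D_EB E B)))"

definition min_over_dual ::
  "('g :: {finite, ab_group_add} set \<Rightarrow> ('g \<Rightarrow> complex) set \<Rightarrow> ereal) \<Rightarrow> 'g set \<Rightarrow> ereal" where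
  "min_over_dual Q E = Min {Q E B | B. B \<subseteq> dual \<and> card B = card E}"

definition rho :: "'g :: {finite, ab_group_add} set \<Rightarrow> ereal" where
  "rho E = min_over_dual rho_EB E"

definition norm_L :: "'g :: {finite, ab_group_add} set \<Rightarrow> ereal" where
  "norm_L E = min_over_dual norm_L_EB E"

definition norm_U :: "'g :: {finite, ab_group_add} set \<Rightarrow> ereal" where
  "norm_U E = min_over_dual norm_U_EB E"

definition norm_rho :: "'g :: {finite, ab_group_add} set \<Rightarrow> ereal" where
  "norm_rho E = min_over_dual norm_rho_EB E"

definition norm_D :: "'g :: {finite, ab_group_add} set \<Rightarrow> ereal" where
  "norm_D E = min_over_dual norm_D_EB E"

definition spectral :: "'g :: {finite, ab_group_add} set \<Rightarrow> bool" where
  "spectral E \<longleftrightarrow>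
     (\<exists>B \<subseteq> dual. card B = card E \<and>
        (\<forall>i < card B. \<forall>j < card B. i \<noteq> j \<longrightarrow>
           col (char_mat E B) i \<bullet>c col (char_mat E B) j = 0))"

end

theory Submission
  imports Defs "Jordan_Normal_Form.Spectral_Radius"
begin

text \<open>
  Let \<open>m = |K|\<close>. Every character of \<open>H \<times> K\<close> is a product \<open>\<chi> \<psi>\<close> with \<open>\<chi>\<close> in the dual of \<open>H\<close> and
  \<open>\<psi>\<close> in the dual of \<open>K\<close>, so a set \<open>B\<close> of characters splits into fibres \<open>B\<^sub>\<psi>\<close>. By orthogonality of
  the characters of \<open>K\<close>, the form \<open>v \<mapsto> \<parallel>T(E,B) v\<parallel>\<^sup>2\<close> is the orthogonal sum over \<open>\<psi>\<close> of \<open>m\<close> times the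
  corresponding forms of \<open>T(E\<^sub>1,B\<^sub>\<psi>)\<close>, and the Gram matrix of \<open>T(E,B)\<close> is block diagonal.

  Taking \<open>B = B\<^sub>1 \<times> dual K\<close> makes all fibres equal to \<open>B\<^sub>1\<close>, so no normalized quantity of \<open>E\<close> exceeds
  that of \<open>E\<^sub>1\<close>. Conversely, since \<open>|dual K| = m\<close>, some fibre of \<open>B\<close> has at least \<open>|E\<^sub>1|\<close> elements, and
  any \<open>|E\<^sub>1|\<close> of them do at least as well as \<open>B\<close> for the extreme singular values. If \<open>T(E,B)\<close> is
  nonsingular, all fibres have exactly \<open>|E\<^sub>1|\<close> elements, and the determinant, being a product over the
  fibres, is beaten by the best fibre.
\<close>

subsection \<open>Duality for finite abelian groups\<close>

primrec nat_mult :: "nat \<Rightarrow> 'a \<Rightarrow> 'a :: comm_monoid_add" where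
  "nat_mult 0 a = 0"
| "nat_mult (Suc k) a = a + nat_mult k a"

lemma nat_mult_add: "nat_mult (k + l) a = nat_mult k a + nat_mult l a"
  by (induction k) (simp_all add: add.assoc)

lemma nat_mult_mult: "nat_mult (k * l) a = nat_mult k (nat_mult l a)"
  by (induction k) (simp_all add: nat_mult_add)

text \<open>Translation by \<open>x\<close> is an injective self-map of the finite set
  \<open>S\<close>, hence onto, so \<open>0\<close> is hit. This is why \<open>0\<close> and closure
  under addition are enough to encode subgroups below.\<close>

lemma uminus_mem_if_add_closed:
  fixes S :: "'a :: {finite, ab_group_add} set"
  assumes "0 \<in> S" "\<And>x y. x \<in> S \<Longrightarrow> y \<in> S \<Longrightarrow> x + y \<in> S" "x \<in> S"
  shows "- x \<in> S"
proof -
  have "(+) x ` S = S"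
    using assms by (intro endo_inj_surj) auto
  then obtain y where "y \<in> S" "0 = x + y"
    using assms(1) by (metis imageE)
  then show ?thesis
    by (simp add: eq_neg_iff_add_eq_0 add.commute minus_unique)
qed

lemma nat_mult_mem:
  assumes "0 \<in> S" "\<And>x y. x \<in> S \<Longrightarrow> y \<in> S \<Longrightarrow> x + y \<in> S" "a \<in> S"
  shows "nat_mult k a \<in> S"
  using assms by (induction k) auto

text \<open>A character of the subgroup \<open>S\<close>, with no constraint on the values off
  \<open>S\<close>. Such characters are extended step by step to prove that \<open>dual\<close>
  separates points.\<close>

definition partial_character :: "'a set \<Rightarrow> ('a :: ab_group_add \<Rightarrow> complex) \<Rightarrow> bool" where
  "partial_character S \<chi> \<longleftrightarrow> 0 \<in> S \<and> (\<forall>x\<in>S. \<forall>y\<in>S. x + y \<in> S \<and> \<chi> (x + y) = \<chi> x * \<chi> y) \<and>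
     (\<forall>x\<in>S. cmod (\<chi> x) = 1)"

lemma partial_characterD:
  assumes "partial_character S \<chi>"
  shows "0 \<in> S" "x \<in> S \<Longrightarrow> y \<in> S \<Longrightarrow> x + y \<in> S"
    "x \<in> S \<Longrightarrow> y \<in> S \<Longrightarrow> \<chi> (x + y) = \<chi> x * \<chi> y" "x \<in> S \<Longrightarrow> cmod (\<chi> x) = 1"
  using assms by (auto simp: partial_character_def)

lemma partial_character_zero:
  assumes "partial_character S \<chi>"
  shows "\<chi> 0 = 1"
proof -
  note D = partial_characterD[OF assms]
  have "\<chi> 0 = \<chi> 0 * \<chi> 0" using D(3)[OF D(1) D(1)] by simp
  moreover have "\<chi> 0 \<noteq> 0" using D(4)[OF D(1)] by force
  ultimately show ?thesis by simp
qed

lemma partial_character_nat_mult: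
  assumes "partial_character S \<chi>" "a \<in> S"
  shows "\<chi> (nat_mult k a) = \<chi> a ^ k"
proof (induction k)
  case 0
  then show ?case using partial_character_zero[OF assms(1)] by simp
next
  case (Suc k)
  note D = partial_characterD[OF assms(1)]
  have "nat_mult k a \<in> S" using nat_mult_mem D(1,2) assms(2) by blast
  then show ?case using D(3)[OF assms(2)] Suc by simp
qed

text \<open>Pigeonhole: two multiples of \<open>a\<close> coincide in a finite group, and their
  difference is a positive multiple equal to \<open>0\<close>.\<close>

lemma ex_nat_mult_mem:
  fixes S :: "'a :: {finite, ab_group_add} set"
  assumes "0 \<in> S"
  shows "\<exists>r>0. nat_mult r a \<in> S"
proof -
  have "\<not> inj (\<lambda>k. nat_mult k a)"
    using finite_imageD[of "\<lambda>k. nat_mult k a" "UNIV :: nat set"] by (auto simp: finite_subset)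
  then obtain k l where kl: "k < l" "nat_mult k a = nat_mult l a"
    by (metis injI linorder_neqE_nat)
  have "nat_mult l a = nat_mult (l - k) a + nat_mult k a"
    using kl(1) by (simp flip: nat_mult_add)
  then have "nat_mult (l - k) a = 0" using kl(2) by simp
  then show ?thesis using kl(1) assms by (intro exI[of _ "l - k"]) auto
qed

text \<open>The subgroup generated by \<open>S\<close> and \<open>a\<close> works. Here
  \<open>r\<close> is the order of \<open>a\<close> modulo \<open>S\<close>, and any
  \<open>r\<close>-th root of \<open>\<chi> (nat_mult r a)\<close> is a legitimate value at
  \<open>a\<close>. Leaving the root \<open>\<omega>\<close> free is what later permits a value
  other than \<open>1\<close>.\<close>

lemma partial_character_extend:
  fixes S :: "'a :: {finite, ab_group_add} set"
  assumes pc: "partial_character S \<chi>"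
    and r: "r = (LEAST r. r > 0 \<and> nat_mult r a \<in> S)" and w: "\<omega> ^ r = \<chi> (nat_mult r a)"
  shows "\<exists>S' \<chi>'. partial_character S' \<chi>' \<and> S \<subseteq> S' \<and> a \<in> S' \<and> (\<forall>x\<in>S. \<chi>' x = \<chi> x) \<and> \<chi>' a = \<omega>"
proof -
  note D = partial_characterD[OF pc]
  have neg: "- x \<in> S" if "x \<in> S" for x
    using uminus_mem_if_add_closed D(1,2) that by blast
  have r0: "r > 0" "nat_mult r a \<in> S"
    using LeastI_ex[OF ex_nat_mult_mem[OF D(1), of a]] r by auto
  have rmin: "r \<le> k" if "k > 0" "nat_mult k a \<in> S" for k
    using that r by (auto intro: Least_le)
  \<comment> \<open>Division with remainder: a nonzero remainder would be a positive factor below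
    \<open>r\<close> whose multiple of \<open>a\<close> lies in \<open>S\<close>.\<close>
  have rdvd: "r dvd k" if "nat_mult k a \<in> S" for k
  proof (rule ccontr)
    assume "\<not> r dvd k"
    then have pos: "k mod r > 0" by (simp add: mod_greater_zero_iff_not_dvd)
    have "nat_mult k a = nat_mult (k div r) (nat_mult r a) + nat_mult (k mod r) a"
      by (simp flip: nat_mult_mult nat_mult_add)
    then have "nat_mult (k mod r) a = nat_mult k a + - nat_mult (k div r) (nat_mult r a)"
      by simp
    moreover have "nat_mult (k div r) (nat_mult r a) \<in> S"
      using nat_mult_mem D(1,2) r0(2) by blast
    ultimately have "nat_mult (k mod r) a \<in> S"
      using D(2)[OF that neg] by simp
    then show False using rmin[OF pos] mod_less_divisor[OF r0(1), of k] by linarith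
  qed
  have norm_w: "cmod \<omega> = 1"
  proof -
    have "cmod \<omega> ^ r = 1 ^ r" using w D(4)[OF r0(2)] by (metis norm_power power_one)
    then show ?thesis using power_eq_imp_eq_base[of "cmod \<omega>" r 1] r0(1) by auto
  qed
  \<comment> \<open>Well-definedness: two representations of one element differ by a multiple of
    \<open>a\<close> that lies in \<open>S\<close>. Its factor \<open>l - k\<close> is divisible by
    \<open>r\<close>, and on such multiples \<open>\<chi>\<close> is already given by powers of
    \<open>\<omega>\<close>.\<close>
  have wd: "\<chi> s * \<omega> ^ k = \<chi> t * \<omega> ^ l"
    if "s \<in> S" "t \<in> S" "s + nat_mult k a = t + nat_mult l a" "k \<le> l" for s t k l
  proof -
    have split: "nat_mult l a = nat_mult (l - k) a + nat_mult k a"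
      using that(4) by (simp flip: nat_mult_add)
    then have s: "s = t + nat_mult (l - k) a" using that(3) by (simp add: add.assoc[symmetric])
    then have "nat_mult (l - k) a = s + - t" by simp
    then have mem: "nat_mult (l - k) a \<in> S" using D(2)[OF that(1) neg[OF that(2)]] by simp
    then obtain q where q: "l - k = q * r" using rdvd by (metis dvdE mult.commute)
    have "\<chi> (nat_mult (l - k) a) = \<omega> ^ (l - k)"
      unfolding q nat_mult_mult partial_character_nat_mult[OF pc r0(2)] w[symmetric]
      by (simp add: power_mult mult.commute flip: power_mult)
    then have "\<chi> s = \<chi> t * \<omega> ^ (l - k)" using s D(3) mem that(2) by simp
    then show ?thesis using that(4) by (simp add: mult.assoc flip: power_add)
  qed
  define S' where "S' = {s + nat_mult k a | s k. s \<in> S}"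
  define P where "P = (\<lambda>z p. fst p \<in> S \<and> z = fst p + nat_mult (snd p) a)"
  \<comment> \<open>\<open>SOME\<close> picks an arbitrary representation of \<open>z\<close>;
    \<open>val\<close> shows that the choice does not matter.\<close>
  define \<chi>' where "\<chi>' = (\<lambda>z. let p = SOME p. P z p in \<chi> (fst p) * \<omega> ^ snd p)"
  have val: "\<chi>' (s + nat_mult k a) = \<chi> s * \<omega> ^ k" if "s \<in> S" for s k
  proof -
    define p where "p = (SOME p. P (s + nat_mult k a) p)"
    have "P (s + nat_mult k a) p"
      unfolding p_def by (rule someI[of _ "(s, k)"]) (auto simp: P_def that)
    then have p: "fst p \<in> S" "s + nat_mult k a = fst p + nat_mult (snd p) a" by (auto simp: P_def)
    have "\<chi>' (s + nat_mult k a) = \<chi> (fst p) * \<omega> ^ snd p"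
      unfolding \<chi>'_def p_def Let_def ..
    also have "\<dots> = \<chi> s * \<omega> ^ k"
      using wd[OF that p] wd[OF p(1) that p(2)[symmetric]] by (cases "k \<le> snd p") auto
    finally show ?thesis .
  qed
  have "partial_character S' \<chi>'"
    unfolding partial_character_def
  proof (intro conjI ballI)
    show "0 \<in> S'" unfolding S'_def using D(1) by (auto intro!: exI[of _ 0])
  next
    fix x y assume "x \<in> S'" "y \<in> S'"
    then obtain s k t l where xy: "x = s + nat_mult k a" "s \<in> S" "y = t + nat_mult l a" "t \<in> S"
      unfolding S'_def by blast
    then have eq: "x + y = (s + t) + nat_mult (k + l) a" by (simp add: nat_mult_add algebra_simps)
    show "x + y \<in> S'" unfolding S'_def eq using xy D(2) by blast
    show "\<chi>' (x + y) = \<chi>' x * \<chi>' y"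
      unfolding eq using xy val D(2,3) by (simp add: power_add mult_ac)
  next
    fix x assume "x \<in> S'"
    then obtain s k where x: "x = s + nat_mult k a" "s \<in> S" unfolding S'_def by blast
    then show "cmod (\<chi>' x) = 1" using val D(4) norm_w by (simp add: norm_mult norm_power)
  qed
  moreover have "\<chi>' x = \<chi> x" "x \<in> S'" if "x \<in> S" for x
    using val[OF that, of 0] that unfolding S'_def by (auto intro!: exI[of _ "0 :: nat"] exI[of _ x])
  moreover have "\<chi>' a = \<omega>" "a \<in> S'"
    using val[OF D(1), of 1] D(1) partial_character_zero[OF pc]
    unfolding S'_def by (auto intro!: exI[of _ "0 :: 'a"] exI[of _ "Suc 0"])
  ultimately show ?thesis by blast
qed

lemma dual_add: "\<chi> \<in> dual \<Longrightarrow> \<chi> (x + y) = \<chi> x * \<chi> y"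
  and dual_norm: "\<chi> \<in> dual \<Longrightarrow> cmod (\<chi> x) = 1"
  by (auto simp: dual_def)

lemma dual_iff_partial_character: "\<chi> \<in> dual \<longleftrightarrow> partial_character UNIV \<chi>"
  by (auto simp: dual_def partial_character_def)

lemma dual_zero: "\<chi> \<in> dual \<Longrightarrow> \<chi> 0 = 1"
  using partial_character_zero dual_iff_partial_character by blast

lemma dual_cnj_mult: "\<chi> \<in> dual \<Longrightarrow> cnj (\<chi> x) * \<chi> x = 1"
  using dual_norm[of \<chi> x] by (simp add: mult.commute flip: complex_norm_square)

text \<open>First the trivial character of \<open>{0}\<close> is extended so that its value at
  \<open>x\<close> is not \<open>1\<close>. Among all subgroups carrying such a character, one of
  largest cardinality must be the whole group, since otherwise it could be extended once
  more.\<close>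

lemma ex_dual_separating:
  fixes x :: "'a :: {finite, ab_group_add}"
  assumes "x \<noteq> 0"
  shows "\<exists>\<chi>\<in>dual. \<chi> x \<noteq> 1"
proof -
  define good where "good = (\<lambda>S. \<exists>\<chi>. partial_character S \<chi> \<and> x \<in> S \<and> \<chi> x \<noteq> 1)"
  have "\<exists>S. good S"
  proof -
    have pc: "partial_character {0 :: 'a} (\<lambda>_. 1)" by (auto simp: partial_character_def)
    define r where "r = (LEAST r. r > 0 \<and> nat_mult r x \<in> {0})"
    have r0: "r > 0 \<and> nat_mult r x \<in> {0}"
      unfolding r_def by (rule LeastI_ex) (use ex_nat_mult_mem[of "{0}" x] in auto)
    moreover have "r \<noteq> 1" using r0 assms by auto
    ultimately have "r > 1" by simp
    \<comment> \<open>There are \<open>r > 1\<close> roots of unity of order dividing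
      \<open>r\<close>, so one of them differs from \<open>1\<close>.\<close>
    then have "card {z :: complex. z ^ r = 1} > 1" by (subst card_roots_unity_eq) auto
    moreover have "card {z :: complex. z ^ r = 1} \<le> 1" if "{z :: complex. z ^ r = 1} \<subseteq> {1}"
      using card_mono[OF _ that] by simp
    ultimately obtain \<omega> :: complex where w: "\<omega> ^ r = 1" "\<omega> \<noteq> 1" by fastforce
    show ?thesis
      using partial_character_extend[OF pc r_def, of \<omega>] w unfolding good_def by auto
  qed
  \<comment> \<open>The cardinality of the group bounds that of every good set, so a largest one
    exists.\<close>
  then obtain S where S: "good S" "\<And>T. good T \<Longrightarrow> card T \<le> card S"
    using ex_has_greatest_nat[of good _ card "card (UNIV :: 'a set) + 1"]
    by (metis card_mono finite less_Suc_eq_le subset_UNIV Suc_eq_plus1)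
  then obtain \<chi> where \<chi>: "partial_character S \<chi>" "x \<in> S" "\<chi> x \<noteq> 1" unfolding good_def by blast
  have "a \<in> S" for a
  proof (rule ccontr)
    assume a: "a \<notin> S"
    define r where "r = (LEAST r. r > 0 \<and> nat_mult r a \<in> S)"
    have r0: "r > 0" "nat_mult r a \<in> S"
      using LeastI_ex[OF ex_nat_mult_mem[OF partial_characterD(1)[OF \<chi>(1)], of a]]
      unfolding r_def by auto
    have "\<chi> (nat_mult r a) \<noteq> 0" using partial_characterD(4)[OF \<chi>(1) r0(2)] by auto
    then have "card {z. z ^ r = \<chi> (nat_mult r a)} = r" using r0(1) by (intro card_nth_roots) auto
    then obtain \<omega> where "\<omega> ^ r = \<chi> (nat_mult r a)" using r0(1)
      by (metis (mono_tags, lifting) card.empty empty_Collect_eq less_numeral_extra(3))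
    from partial_character_extend[OF \<chi>(1) r_def this]
    obtain S' \<chi>' where S': "partial_character S' \<chi>'" "S \<subseteq> S'" "a \<in> S'" "\<forall>x\<in>S. \<chi>' x = \<chi> x" by blast
    then have "good S'" unfolding good_def using \<chi> by auto
    then have "card S' \<le> card S" using S(2) by blast
    then have "S = S'" using S'(2) by (simp add: card_seteq)
    then show False using a S'(3) by simp
  qed
  then have "S = UNIV" by blast
  then show ?thesis using \<chi> dual_iff_partial_character by auto
qed

text \<open>Multiplying all values of \<open>\<chi>\<close> and translating the argument by
  \<open>x\<close> gives \<open>\<chi> x ^ ?N = 1\<close>. Hence characters map a finite set into a
  finite set of roots of unity.\<close>

lemma finite_dual: "finite (dual :: ('a :: {finite, ab_group_add} \<Rightarrow> complex) set)"
proof -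
  let ?N = "card (UNIV :: 'a set)"
  have N: "?N > 0" by (simp add: card_gt_0_iff)
  have root: "\<chi> x ^ ?N = 1" if "\<chi> \<in> dual" for \<chi> and x :: 'a
  proof -
    have "(\<Prod>y\<in>UNIV. \<chi> y) = (\<Prod>y\<in>UNIV. \<chi> (x + y))"
      by (rule prod.reindex_bij_witness[of _ "\<lambda>y. x + y" "\<lambda>y. y - x"]) auto
    also have "\<dots> = \<chi> x ^ ?N * (\<Prod>y\<in>UNIV. \<chi> y)"
      by (simp add: dual_add[OF that] prod.distrib)
    finally have "(\<Prod>y\<in>UNIV. \<chi> y) = \<chi> x ^ ?N * (\<Prod>y\<in>UNIV. \<chi> y)" .
    moreover have "(\<Prod>y\<in>UNIV. \<chi> y) \<noteq> 0"
      using dual_norm[OF that] by (auto simp: prod_zero_iff) (metis norm_zero zero_neq_one)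
    ultimately show ?thesis by simp
  qed
  have "finite {f :: 'a \<Rightarrow> complex. \<forall>x. (x \<in> UNIV \<longrightarrow> f x \<in> {z. z ^ ?N = 1}) \<and> (x \<notin> UNIV \<longrightarrow> f x = 0)}"
    using N by (intro finite_set_of_finite_funs finite_roots_unity) auto
  then show ?thesis by (rule finite_subset[rotated]) (use root in auto)
qed

text \<open>Translation by \<open>a\<close> leaves the sum unchanged but multiplies it by
  \<open>\<chi> a\<close>.\<close>

lemma sum_dual_over_group:
  fixes \<chi> :: "'a :: {finite, ab_group_add} \<Rightarrow> complex"
  assumes "\<chi> \<in> dual" "\<chi> a \<noteq> 1"
  shows "(\<Sum>x\<in>UNIV. \<chi> x) = 0"
proof -
  have "(\<Sum>x\<in>UNIV. \<chi> x) = (\<Sum>x\<in>UNIV. \<chi> (a + x))"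
    by (rule sum.reindex_bij_witness[of _ "\<lambda>y. a + y" "\<lambda>y. y - a"]) auto
  also have "\<dots> = \<chi> a * (\<Sum>x\<in>UNIV. \<chi> x)" by (simp add: dual_add[OF assms(1)] sum_distrib_left)
  finally show ?thesis using assms(2) by simp
qed

lemma dual_mult: "\<chi> \<in> dual \<Longrightarrow> \<psi> \<in> dual \<Longrightarrow> (\<lambda>x. \<chi> x * \<psi> x) \<in> dual"
  and dual_cnj: "\<chi> \<in> dual \<Longrightarrow> (\<lambda>x. cnj (\<chi> x)) \<in> dual"
  and dual_one: "(\<lambda>x. 1) \<in> dual"
  by (auto simp: dual_def norm_mult)

text \<open>The translation argument carried out in the dual group, with a character
  \<open>\<phi>\<close> separating \<open>a\<close> from \<open>0\<close>. Multiplication by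
  \<open>\<phi>\<close> is inverted by multiplication by its conjugate.\<close>

lemma sum_over_dual:
  fixes a :: "'a :: {finite, ab_group_add}"
  assumes "a \<noteq> 0"
  shows "(\<Sum>\<chi>\<in>dual. \<chi> a) = 0"
proof -
  obtain \<phi> where phi: "\<phi> \<in> dual" "\<phi> a \<noteq> 1" using ex_dual_separating[OF assms] by blast
  have "(\<Sum>\<chi>\<in>dual. \<chi> a) = (\<Sum>\<chi>\<in>dual. \<phi> a * \<chi> a)"
    by (rule sum.reindex_bij_witness[of _ "\<lambda>\<chi> x. \<phi> x * \<chi> x" "\<lambda>\<chi> x. cnj (\<phi> x) * \<chi> x"])
       (use dual_cnj_mult[OF phi(1)] in \<open>auto intro!: dual_mult dual_cnj phi
         simp: fun_eq_iff mult.assoc[symmetric] mult.commute[of "\<phi> _"]\<close>)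
  also have "\<dots> = \<phi> a * (\<Sum>\<chi>\<in>dual. \<chi> a)" by (simp add: sum_distrib_left)
  finally show ?thesis using phi(2) by simp
qed

text \<open>Double counting of the sum of \<open>\<chi> x\<close> over all pairs: only
  \<open>x = 0\<close> contributes when characters are summed first, only the trivial character when
  group elements are.\<close>

lemma card_dual: "card (dual :: ('a :: {finite, ab_group_add} \<Rightarrow> complex) set) = card (UNIV :: 'a set)"
proof -
  let ?D = "dual :: ('a \<Rightarrow> complex) set"
  have "(\<Sum>x\<in>UNIV. \<Sum>\<chi>\<in>?D. \<chi> x) = (\<Sum>x\<in>(UNIV :: 'a set). if x = 0 then of_nat (card ?D) else 0)"
    by (intro sum.cong refl) (simp add: sum_over_dual dual_zero)
  then have 1: "(\<Sum>x\<in>UNIV. \<Sum>\<chi>\<in>?D. \<chi> x) = of_nat (card ?D)" by simp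
  have "(\<Sum>\<chi>\<in>?D. \<Sum>x\<in>UNIV. \<chi> x)
      = (\<Sum>\<chi>\<in>?D. if \<chi> = (\<lambda>_. 1) then of_nat (card (UNIV :: 'a set)) else 0)"
    by (intro sum.cong refl) (auto simp: fun_eq_iff intro: sum_dual_over_group)
  then have 2: "(\<Sum>\<chi>\<in>?D. \<Sum>x\<in>UNIV. \<chi> x) = of_nat (card (UNIV :: 'a set))"
    by (simp add: dual_one finite_dual sum.delta)
  have "(of_nat (card ?D) :: complex) = of_nat (card (UNIV :: 'a set))"
    using 1 2 sum.swap[of "\<lambda>x \<chi>. \<chi> x" ?D UNIV] by metis
  then show ?thesis by (simp only: of_nat_eq_iff)
qed

text \<open>For distinct characters the product \<open>cnj (\<chi> x) * \<psi> x\<close> is a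
  nontrivial character, whose sum vanishes.\<close>

lemma dual_orthogonal:
  fixes \<chi> :: "'a :: {finite, ab_group_add} \<Rightarrow> complex"
  assumes "\<chi> \<in> dual" "\<psi> \<in> dual"
  shows "(\<Sum>x\<in>UNIV. cnj (\<chi> x) * \<psi> x) = (if \<chi> = \<psi> then of_nat (card (UNIV :: 'a set)) else 0)"
proof (cases "\<chi> = \<psi>")
  case True
  then show ?thesis using dual_cnj_mult[OF assms(1)] by simp
next
  case False
  then obtain a where "\<chi> a \<noteq> \<psi> a" by (auto simp: fun_eq_iff)
  then have "cnj (\<chi> a) * \<psi> a \<noteq> 1"
    using dual_cnj_mult[OF assms(1), of a] dual_norm[OF assms(1), of a]
    by (metis complex_cnj_zero mult_cancel_left mult_zero_left zero_neq_one)
  then show ?thesis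
    using False sum_dual_over_group[OF dual_mult[OF dual_cnj[OF assms(1)] assms(2)]] by simp
qed

subsection \<open>Singular values as extrema of a quadratic form\<close>

definition sqnorm :: "complex vec \<Rightarrow> real" where
  "sqnorm v = (\<Sum>i<dim_vec v. (cmod (v $ i))\<^sup>2)"

lemma sqnorm_nonneg [simp]: "0 \<le> sqnorm v"
  by (simp add: sqnorm_def sum_nonneg)

lemma vec_norm2_eq: "vec_norm2 v = sqrt (sqnorm v)"
  by (simp add: vec_norm2_def sqnorm_def)

lemma sqnorm_eq_0_iff: "v \<in> carrier_vec n \<Longrightarrow> sqnorm v = 0 \<longleftrightarrow> v = 0\<^sub>v n"
  by (auto simp: sqnorm_def sum_nonneg_eq_0_iff)

lemma sqnorm_smult: "sqnorm (k \<cdot>\<^sub>v v) = (cmod k)\<^sup>2 * sqnorm v"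
  by (simp add: sqnorm_def norm_mult power_mult_distrib sum_distrib_left)

lemma cscalar_prod_self: "v \<bullet>c v = complex_of_real (sqnorm v)"
  by (simp add: sqnorm_def scalar_prod_def lessThan_atLeast0 conjugate_complex_def
      complex_norm_square[symmetric])

lemma cmod_diff_scaled:
  "(cmod (a - of_real t * b))\<^sup>2 = (cmod a)\<^sup>2 - 2 * t * Re (a * cnj b) + t\<^sup>2 * (cmod b)\<^sup>2"
  unfolding cmod_power2 by (simp add: power2_eq_square algebra_simps)

lemma sqnorm_diff:
  assumes "u \<in> carrier_vec n" "v \<in> carrier_vec n"
  shows "sqnorm (u - complex_of_real t \<cdot>\<^sub>v v) = sqnorm u - 2 * t * Re (u \<bullet>c v) + t\<^sup>2 * sqnorm v"
proof -
  have "sqnorm (u - complex_of_real t \<cdot>\<^sub>v v) = (\<Sum>i<n. (cmod (u $ i - of_real t * v $ i))\<^sup>2)"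
    using assms by (simp add: sqnorm_def)
  also have "\<dots> = (\<Sum>i<n. (cmod (u $ i))\<^sup>2) - 2 * t * (\<Sum>i<n. Re (u $ i * cnj (v $ i)))
      + t\<^sup>2 * (\<Sum>i<n. (cmod (v $ i))\<^sup>2)"
    unfolding cmod_diff_scaled by (simp only: sum.distrib sum_subtractf sum_distrib_left)
  also have "(\<Sum>i<n. Re (u $ i * cnj (v $ i))) = Re (u \<bullet>c v)"
    using assms by (simp add: scalar_prod_def lessThan_atLeast0)
  finally show ?thesis using assms by (simp add: sqnorm_def)
qed

lemma mat_adjoint_carrier: "A \<in> carrier_mat r n \<Longrightarrow> mat_adjoint A \<in> carrier_mat n r"
  by (simp add: mat_adjoint_def mat_of_rows_def)

lemma mat_adjoint_index:
  "A \<in> carrier_mat r n \<Longrightarrow> i < n \<Longrightarrow> j < r \<Longrightarrow> mat_adjoint A $$ (i, j) = cnj (A $$ (j, i))"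
  by (auto simp: mat_adjoint_def mat_of_rows_index)

lemma cscalar_prod_mat_adjoint:
  fixes A :: "complex mat"
  assumes A: "A \<in> carrier_mat r n" and w: "w \<in> carrier_vec r" and v: "v \<in> carrier_vec n"
  shows "(mat_adjoint A *\<^sub>v w) \<bullet>c v = w \<bullet>c (A *\<^sub>v v)"
proof -
  have "(mat_adjoint A *\<^sub>v w) \<bullet>c v = (\<Sum>j<n. \<Sum>i<r. cnj (A $$ (i, j)) * w $ i * cnj (v $ j))"
    using A w v mat_adjoint_carrier[OF A]
    by (simp add: scalar_prod_def lessThan_atLeast0 mat_adjoint_index sum_distrib_right)
  also have "\<dots> = (\<Sum>i<r. \<Sum>j<n. cnj (A $$ (i, j)) * w $ i * cnj (v $ j))"
    by (rule sum.swap)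
  also have "\<dots> = w \<bullet>c (A *\<^sub>v v)"
    using A w v by (simp add: scalar_prod_def lessThan_atLeast0 sum_distrib_left mult_ac)
  finally show ?thesis .
qed

lemma cscalar_prod_gram:
  fixes A :: "complex mat"
  assumes A: "A \<in> carrier_mat r n" and u: "u \<in> carrier_vec n" and v: "v \<in> carrier_vec n"
  shows "(mat_adjoint A * A *\<^sub>v u) \<bullet>c v = (A *\<^sub>v u) \<bullet>c (A *\<^sub>v v)"
  using cscalar_prod_mat_adjoint[OF A _ v, of "A *\<^sub>v u"] A u mat_adjoint_carrier[OF A] by simp

text \<open>A crude bound through the row sums of absolute values; only the existence of some
  \<open>K\<close> matters. The summand \<open>1\<close> in \<open>K\<close> makes it positive, so
  that it can be divided by.\<close>

lemma sqnorm_mult_mat_vec_bounded: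
  assumes A: "A \<in> carrier_mat r n"
  shows "\<exists>K>0. \<forall>u\<in>carrier_vec n. sqnorm (A *\<^sub>v u) \<le> K * sqnorm u"
proof -
  define K where "K = 1 + (\<Sum>i<r. (\<Sum>j<n. cmod (A $$ (i, j)))\<^sup>2)"
  have "sqnorm (A *\<^sub>v u) \<le> K * sqnorm u" if u: "u \<in> carrier_vec n" for u
  proof -
    have entry: "cmod (u $ j) \<le> sqrt (sqnorm u)" if "j < n" for j
      using u that by (intro real_le_rsqrt) (auto simp: sqnorm_def intro!: member_le_sum)
    have "(cmod ((A *\<^sub>v u) $ i))\<^sup>2 \<le> (\<Sum>j<n. cmod (A $$ (i, j)))\<^sup>2 * sqnorm u" if "i < r" for i
    proof -
      have "cmod ((A *\<^sub>v u) $ i) = cmod (\<Sum>j<n. A $$ (i, j) * u $ j)"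
        using A u that by (simp add: scalar_prod_def lessThan_atLeast0)
      also have "\<dots> \<le> (\<Sum>j<n. cmod (A $$ (i, j)) * sqrt (sqnorm u))"
        using entry by (intro sum_norm_le) (simp add: norm_mult mult_left_mono)
      also have "\<dots> = (\<Sum>j<n. cmod (A $$ (i, j))) * sqrt (sqnorm u)"
        by (simp add: sum_distrib_right)
      finally have "(cmod ((A *\<^sub>v u) $ i))\<^sup>2 \<le> ((\<Sum>j<n. cmod (A $$ (i, j))) * sqrt (sqnorm u))\<^sup>2"
        by (intro power_mono) auto
      then show ?thesis by (simp add: power_mult_distrib)
    qed
    then have "sqnorm (A *\<^sub>v u) \<le> (\<Sum>i<r. (\<Sum>j<n. cmod (A $$ (i, j)))\<^sup>2 * sqnorm u)"
      using A by (auto simp: sqnorm_def[of "A *\<^sub>v u"] intro!: sum_mono)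
    also have "\<dots> \<le> K * sqnorm u"
      by (simp add: K_def distrib_right sum_distrib_right)
    finally show ?thesis .
  qed
  moreover have "K > 0" by (auto simp: K_def intro!: add_pos_nonneg sum_nonneg)
  ultimately show ?thesis by blast
qed

lemma smult_one_mult_vec:
  fixes u :: "complex vec"
  assumes "u \<in> carrier_vec n"
  shows "(k \<cdot>\<^sub>m 1\<^sub>m n) *\<^sub>v u = k \<cdot>\<^sub>v u"
  using assms by (intro eq_vecI) (auto simp: scalar_prod_left_unit)

lemma ex_sqnorm_1: "0 < n \<Longrightarrow> \<exists>u\<in>carrier_vec n. sqnorm u = 1"
proof (rule bexI[of _ "unit_vec n 0"])
  assume "0 < n"
  have "sqnorm (unit_vec n 0) = (\<Sum>i<n. if i = 0 then 1 else 0)"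
    unfolding sqnorm_def by (intro sum.cong) auto
  then show "sqnorm (unit_vec n 0) = 1" using \<open>0 < n\<close> by simp
qed simp

lemma sqnorm_normalize:
  assumes "u \<in> carrier_vec n" "u \<noteq> 0\<^sub>v n"
  shows "\<exists>c. (cmod c)\<^sup>2 * sqnorm u = 1 \<and> sqnorm (c \<cdot>\<^sub>v u) = 1"
proof -
  have "sqnorm u \<noteq> 0" using assms sqnorm_eq_0_iff by blast
  then have "(cmod (complex_of_real (1 / sqrt (sqnorm u))))\<^sup>2 * sqnorm u = 1"
    by (simp add: norm_divide power_divide)
  then show ?thesis using sqnorm_smult by metis
qed

text \<open>The infimum \<open>c\<close> of the Rayleigh quotient of \<open>A\<^sup>*A\<close> is an eigenvalue: otherwise
  \<open>N = A\<^sup>*A - c\<close> is invertible, and evaluating its nonnegative form \<open>h\<close> at \<open>u - t N u\<close> for small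
  \<open>t\<close> bounds \<open>h u\<close> below by a positive multiple of \<open>\<parallel>N u\<parallel>\<^sup>2\<close>, hence of \<open>\<parallel>u\<parallel>\<^sup>2\<close>.\<close>

lemma ex_min_rayleigh_eigenvalue:
  assumes A: "A \<in> carrier_mat r n" and n: "0 < n"
  shows "\<exists>c\<ge>0. eigenvalue (mat_adjoint A * A) (complex_of_real c) \<and>
           (\<forall>u\<in>carrier_vec n. c * sqnorm u \<le> sqnorm (A *\<^sub>v u))"
proof -
  define R where "R = {sqnorm (A *\<^sub>v u) | u. u \<in> carrier_vec n \<and> sqnorm u = 1}"
  define c where "c = Inf R"
  have R_ne: "R \<noteq> {}" unfolding R_def using ex_sqnorm_1[OF n] by blast
  have R_bdd: "bdd_below R" unfolding R_def by (rule bdd_belowI[of _ 0]) auto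
  have c0: "c \<ge> 0" unfolding c_def using R_ne by (rule cInf_greatest) (auto simp: R_def)
  have c_le: "c * sqnorm u \<le> sqnorm (A *\<^sub>v u)" if u: "u \<in> carrier_vec n" for u
  proof (cases "u = 0\<^sub>v n")
    case True
    then show ?thesis using sqnorm_eq_0_iff[OF u] by simp
  next
    case False
    obtain k where k: "(cmod k)\<^sup>2 * sqnorm u = 1" "sqnorm (k \<cdot>\<^sub>v u) = 1"
      using sqnorm_normalize[OF u False] by blast
    have "sqnorm (A *\<^sub>v (k \<cdot>\<^sub>v u)) \<in> R" unfolding R_def using u k by auto
    then have "c \<le> sqnorm (A *\<^sub>v (k \<cdot>\<^sub>v u))" unfolding c_def using R_bdd by (rule cInf_lower)
    also have "\<dots> = (cmod k)\<^sup>2 * sqnorm (A *\<^sub>v u)" using A u by (simp add: mult_mat_vec sqnorm_smult)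
    finally have "c * sqnorm u \<le> (cmod k)\<^sup>2 * sqnorm (A *\<^sub>v u) * sqnorm u"
      by (intro mult_right_mono) auto
    also have "\<dots> = sqnorm (A *\<^sub>v u)" using k(1) by (simp add: mult_ac)
    finally show ?thesis .
  qed
  define M where "M = mat_adjoint A * A"
  have M: "M \<in> carrier_mat n n" unfolding M_def using A mat_adjoint_carrier[OF A] by simp
  have "eigenvalue M (complex_of_real c)"
  proof (rule ccontr)
    define N where "N = char_matrix M (complex_of_real c)"
    assume "\<not> eigenvalue M (complex_of_real c)"
    then have det: "det N \<noteq> 0" unfolding N_def eigenvalue_det[OF M] .
    have N: "N \<in> carrier_mat n n" unfolding N_def using M by simp
    have N_apply: "N *\<^sub>v u = M *\<^sub>v u - complex_of_real c \<cdot>\<^sub>v u" if u: "u \<in> carrier_vec n" for u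
    proof -
      have "N *\<^sub>v u = M *\<^sub>v u + (- complex_of_real c \<cdot>\<^sub>m 1\<^sub>m n) *\<^sub>v u"
        unfolding N_def char_matrix_def using M u by (subst add_mult_distrib_mat_vec) auto
      also have "(- complex_of_real c \<cdot>\<^sub>m 1\<^sub>m n) *\<^sub>v u = - complex_of_real c \<cdot>\<^sub>v u"
        by (rule smult_one_mult_vec[OF u])
      finally show ?thesis using M u by auto
    qed
    obtain K where K: "K > 0" "\<And>u. u \<in> carrier_vec n \<Longrightarrow> sqnorm (A *\<^sub>v u) \<le> K * sqnorm u"
      using sqnorm_mult_mat_vec_bounded[OF A] by blast
    obtain K' where K': "K' > 0"
        "\<And>u. u \<in> carrier_vec n \<Longrightarrow> sqnorm (adj_mat N *\<^sub>v u) \<le> K' * sqnorm u"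
      using sqnorm_mult_mat_vec_bounded[OF adj_mat(1)[OF N]] by blast
    \<comment> \<open>The adjugate stands in for the inverse: \<open>adj_mat N\<close> maps
      \<open>N *\<^sub>v u\<close> to \<open>det N \<cdot>\<^sub>v u\<close>, which bounds
      \<open>sqnorm u\<close> by \<open>K' / (cmod (det N))\<^sup>2\<close> times the squared norm
      of \<open>N *\<^sub>v u\<close>. The further factor \<open>1 / K\<close> comes from the step
      size \<open>t\<close>.\<close>
    define e where "e = (cmod (det N))\<^sup>2 / (K' * K)"
    have e: "e > 0" unfolding e_def using det K K' by simp
    have gap: "e * sqnorm u \<le> sqnorm (A *\<^sub>v u) - c * sqnorm u" if u: "u \<in> carrier_vec n" for u
    proof -
      define v where "v = N *\<^sub>v u"
      have v: "v \<in> carrier_vec n" unfolding v_def using N u by simp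
      \<comment> \<open>This value minimizes the bound \<open>- 2 * t + t\<^sup>2 * K\<close>, which
        then equals \<open>- 1 / K\<close>.\<close>
      define t where "t = 1 / K"
      \<comment> \<open>The left side is the real part of
        \<open>(N *\<^sub>v u) \<bullet>c v\<close>, and \<open>v\<close> was chosen as
        \<open>N *\<^sub>v u\<close>.\<close>
      have cross: "Re ((A *\<^sub>v u) \<bullet>c (A *\<^sub>v v)) - c * Re (u \<bullet>c v) = sqnorm v"
      proof -
        have "complex_of_real (sqnorm v) = (M *\<^sub>v u - complex_of_real c \<cdot>\<^sub>v u) \<bullet>c v"
          using cscalar_prod_self[of v] N_apply[OF u] unfolding v_def by simp
        also have "\<dots> = (M *\<^sub>v u) \<bullet>c v - complex_of_real c * (u \<bullet>c v)"
          using M u v by (subst minus_scalar_prod_distrib[of _ n]) auto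
        also have "(M *\<^sub>v u) \<bullet>c v = (A *\<^sub>v u) \<bullet>c (A *\<^sub>v v)"
          unfolding M_def by (rule cscalar_prod_gram[OF A u v])
        finally show ?thesis by (metis Re_complex_of_real minus_complex.simps(1) Re_complex_of_real
              times_complex.simps(1) Im_complex_of_real mult_zero_left diff_zero)
      qed
      let ?w = "u - complex_of_real t \<cdot>\<^sub>v v"
      have "A *\<^sub>v ?w = A *\<^sub>v u - complex_of_real t \<cdot>\<^sub>v (A *\<^sub>v v)"
        using A u v by (simp add: mult_minus_distrib_mat_vec mult_mat_vec)
      then have Aw: "sqnorm (A *\<^sub>v ?w) = sqnorm (A *\<^sub>v u)
          - 2 * t * Re ((A *\<^sub>v u) \<bullet>c (A *\<^sub>v v)) + t\<^sup>2 * sqnorm (A *\<^sub>v v)"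
        using sqnorm_diff[of "A *\<^sub>v u" r "A *\<^sub>v v" t] A u v by simp
      have w: "sqnorm ?w = sqnorm u - 2 * t * Re (u \<bullet>c v) + t\<^sup>2 * sqnorm v"
        using sqnorm_diff[OF u v] .
      have "0 \<le> sqnorm (A *\<^sub>v ?w) - c * sqnorm ?w"
        using c_le[of ?w] u v by simp
      also have "\<dots> = (sqnorm (A *\<^sub>v u) - c * sqnorm u)
          - 2 * t * (Re ((A *\<^sub>v u) \<bullet>c (A *\<^sub>v v)) - c * Re (u \<bullet>c v))
          + t\<^sup>2 * (sqnorm (A *\<^sub>v v) - c * sqnorm v)"
        unfolding Aw w by (simp add: algebra_simps)
      also have "\<dots> \<le> (sqnorm (A *\<^sub>v u) - c * sqnorm u) - 2 * t * sqnorm v + t\<^sup>2 * (K * sqnorm v)"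
        using K(2)[OF v] c0 unfolding cross
        by (intro add_left_mono mult_left_mono) (auto intro: add_increasing2 simp: diff_le_eq)
      also have "\<dots> = (sqnorm (A *\<^sub>v u) - c * sqnorm u) - sqnorm v / K"
        using K(1) by (simp add: t_def power2_eq_square field_simps)
      finally have h: "sqnorm v / K \<le> sqnorm (A *\<^sub>v u) - c * sqnorm u" by simp
      have "adj_mat N *\<^sub>v v = det N \<cdot>\<^sub>v u"
      proof -
        have "adj_mat N *\<^sub>v v = (adj_mat N * N) *\<^sub>v u" unfolding v_def using adj_mat(1)[OF N] N u by simp
        also have "\<dots> = (det N \<cdot>\<^sub>m 1\<^sub>m n) *\<^sub>v u" using adj_mat(3)[OF N] by simp
        also have "\<dots> = det N \<cdot>\<^sub>v u"
          by (rule smult_one_mult_vec[OF u])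
        finally show ?thesis .
      qed
      then have "(cmod (det N))\<^sup>2 * sqnorm u \<le> K' * sqnorm v"
        using K'(2)[OF v] by (simp add: sqnorm_smult)
      then have "e * sqnorm u \<le> sqnorm v / K"
        using K(1) K'(1) by (simp add: e_def field_simps)
      then show ?thesis using h by linarith
    qed
    \<comment> \<open>The gap lifts the infimum above itself.\<close>
    have "c + e \<le> Inf R"
      using R_ne
    proof (rule cInf_greatest)
      fix x assume "x \<in> R"
      then obtain u where "u \<in> carrier_vec n" "sqnorm u = 1" "x = sqnorm (A *\<^sub>v u)"
        unfolding R_def by blast
      then show "c + e \<le> x" using gap[of u] by simp
    qed
    then show False using e unfolding c_def by simp
  qed
  then show ?thesis using c0 c_le unfolding M_def by blast
qed

text \<open>Variational form of the least singular value. The set of singular values is finite,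
  since the spectrum is finite and squaring is injective on nonnegative reals. It contains
  \<open>sqrt c\<close> for the minimal Rayleigh quotient \<open>c\<close>, so its minimum squared
  is at most \<open>c\<close>; the eigenvector of that minimum attains equality.\<close>

lemma
  assumes A: "A \<in> carrier_mat r n" and n: "0 < n"
  shows sigma_min_le: "u \<in> carrier_vec n \<Longrightarrow> (sigma_min A)\<^sup>2 * sqnorm u \<le> sqnorm (A *\<^sub>v u)"
    and sigma_min_attained:
      "\<exists>u\<in>carrier_vec n. u \<noteq> 0\<^sub>v n \<and> sqnorm (A *\<^sub>v u) = (sigma_min A)\<^sup>2 * sqnorm u"
proof -
  let ?M = "mat_adjoint A * A"
  have M: "?M \<in> carrier_mat n n" using A mat_adjoint_carrier[OF A] by simp
  have "finite {k. eigenvalue ?M k}"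
    using card_finite_spectrum(1)[OF M] by (simp add: spectrum_def)
  then have "finite ((\<lambda>s. complex_of_real (s\<^sup>2)) -` {k. eigenvalue ?M k} \<inter> {0..})"
    by (rule finite_vimage_IntI) (auto simp: inj_on_def power2_eq_iff_nonneg simp del: of_real_power)
  then have fin: "finite (singular_values A)"
    by (rule finite_subset[rotated]) (auto simp: singular_values_def)
  obtain c where c: "c \<ge> 0" "eigenvalue ?M (complex_of_real c)"
      "\<And>u. u \<in> carrier_vec n \<Longrightarrow> c * sqnorm u \<le> sqnorm (A *\<^sub>v u)"
    using ex_min_rayleigh_eigenvalue[OF A n] by blast
  have c_sv: "sqrt c \<in> singular_values A" using c by (simp add: singular_values_def del: of_real_power)
  then have mem: "sigma_min A \<in> singular_values A"
    unfolding sigma_min_def using fin by (intro Min_in) auto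
  have "sigma_min A \<le> sqrt c" unfolding sigma_min_def using fin c_sv by (rule Min_le)
  then have "(sigma_min A)\<^sup>2 \<le> c"
    using mem c(1)
    by (metis (mono_tags, lifting) mem_Collect_eq power_mono real_sqrt_pow2 singular_values_def)
  then show "(sigma_min A)\<^sup>2 * sqnorm u \<le> sqnorm (A *\<^sub>v u)" if "u \<in> carrier_vec n"
    using c(3)[OF that] by (meson mult_right_mono order_trans sqnorm_nonneg)
  have "eigenvalue ?M (complex_of_real ((sigma_min A)\<^sup>2))" using mem by (simp add: singular_values_def)
  then obtain u where u: "u \<in> carrier_vec n" "u \<noteq> 0\<^sub>v n"
      "?M *\<^sub>v u = complex_of_real ((sigma_min A)\<^sup>2) \<cdot>\<^sub>v u"
    unfolding eigenvalue_def eigenvector_def using M by auto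
  have "complex_of_real (sqnorm (A *\<^sub>v u)) = (?M *\<^sub>v u) \<bullet>c u"
    unfolding cscalar_prod_gram[OF A u(1) u(1)] cscalar_prod_self ..
  also have "\<dots> = complex_of_real ((sigma_min A)\<^sup>2 * sqnorm u)"
    unfolding u(3) using u(1) by (simp add: cscalar_prod_self)
  finally have "sqnorm (A *\<^sub>v u) = (sigma_min A)\<^sup>2 * sqnorm u" by (simp only: of_real_eq_iff)
  then show "\<exists>u\<in>carrier_vec n. u \<noteq> 0\<^sub>v n \<and> sqnorm (A *\<^sub>v u) = (sigma_min A)\<^sup>2 * sqnorm u"
    using u by blast
qed

text \<open>The norm is a supremum over the unit sphere, which is nonempty because
  \<open>0 < n\<close> and on which the values are bounded; scaling to unit length transfers the
  bound to all vectors.\<close>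

lemma
  assumes A: "A \<in> carrier_mat r n" and n: "0 < n"
  shows op_norm2_ge: "u \<in> carrier_vec n \<Longrightarrow> sqnorm (A *\<^sub>v u) \<le> (op_norm2 A)\<^sup>2 * sqnorm u"
    and op_norm2_least:
      "(\<And>u. u \<in> carrier_vec n \<Longrightarrow> sqnorm (A *\<^sub>v u) \<le> c * sqnorm u) \<Longrightarrow> (op_norm2 A)\<^sup>2 \<le> c"
proof -
  define S where "S = {v \<in> carrier_vec n. vec_norm2 v = 1}"
  have on: "op_norm2 A = (SUP v\<in>S. vec_norm2 (A *\<^sub>v v))"
    unfolding op_norm2_def S_def using A by auto
  have S: "v \<in> S \<longleftrightarrow> v \<in> carrier_vec n \<and> sqnorm v = 1" for v
    by (auto simp: S_def vec_norm2_eq)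
  have ne: "S \<noteq> {}" using ex_sqnorm_1[OF n] S by blast
  obtain K where K: "K > 0" "\<And>u. u \<in> carrier_vec n \<Longrightarrow> sqnorm (A *\<^sub>v u) \<le> K * sqnorm u"
    using sqnorm_mult_mat_vec_bounded[OF A] by blast
  have bdd: "bdd_above ((\<lambda>v. vec_norm2 (A *\<^sub>v v)) ` S)"
    by (rule bdd_aboveI2[of _ _ "sqrt K"]) (use K(2) in \<open>fastforce simp: S vec_norm2_eq\<close>)
  have up: "sqrt (sqnorm (A *\<^sub>v v)) \<le> op_norm2 A" if "v \<in> S" for v
    using cSUP_upper[OF that bdd] on by (simp add: vec_norm2_eq)
  have nonneg: "0 \<le> op_norm2 A"
    using ne up by (meson ex_in_conv order_trans real_sqrt_ge_zero sqnorm_nonneg)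
  show "sqnorm (A *\<^sub>v u) \<le> (op_norm2 A)\<^sup>2 * sqnorm u" if u: "u \<in> carrier_vec n"
  proof (cases "u = 0\<^sub>v n")
    case True
    then have "sqnorm u = 0" using sqnorm_eq_0_iff[OF u] by simp
    then show ?thesis using K(2)[OF u] by simp
  next
    case False
    obtain k where k: "(cmod k)\<^sup>2 * sqnorm u = 1" "sqnorm (k \<cdot>\<^sub>v u) = 1"
      using sqnorm_normalize[OF u False] by blast
    have "sqrt (sqnorm (A *\<^sub>v (k \<cdot>\<^sub>v u))) \<le> op_norm2 A" using up S u k by auto
    then have "sqnorm (A *\<^sub>v (k \<cdot>\<^sub>v u)) \<le> (op_norm2 A)\<^sup>2" by (rule sqrt_le_D)
    also have "sqnorm (A *\<^sub>v (k \<cdot>\<^sub>v u)) = (cmod k)\<^sup>2 * sqnorm (A *\<^sub>v u)"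
      using A u by (simp add: mult_mat_vec sqnorm_smult)
    finally have "(cmod k)\<^sup>2 * sqnorm (A *\<^sub>v u) * sqnorm u \<le> (op_norm2 A)\<^sup>2 * sqnorm u"
      by (intro mult_right_mono) auto
    also have "(cmod k)\<^sup>2 * sqnorm (A *\<^sub>v u) * sqnorm u = sqnorm (A *\<^sub>v u)"
      using k(1) by (simp add: mult_ac)
    finally show ?thesis .
  qed
  show "(op_norm2 A)\<^sup>2 \<le> c" if c: "\<And>u. u \<in> carrier_vec n \<Longrightarrow> sqnorm (A *\<^sub>v u) \<le> c * sqnorm u"
  proof -
    have "op_norm2 A \<le> sqrt c"
      unfolding on using ne by (rule cSUP_least) (use c in \<open>fastforce simp: S vec_norm2_eq\<close>)
    \<comment> \<open>Evaluation at a unit vector; with it, squaring \<open>sqrt c\<close> returns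
      \<open>c\<close>.\<close>
    moreover have "c \<ge> 0"
    proof -
      obtain u where u: "u \<in> carrier_vec n" "sqnorm u = 1" using ex_sqnorm_1[OF n] by blast
      then show ?thesis using order_trans[OF sqnorm_nonneg c[OF u(1)]] by simp
    qed
    ultimately show ?thesis using nonneg power_mono[of "op_norm2 A" "sqrt c" 2] by simp
  qed
qed

section \<open>The quadratic form of \<open>T(E,B)\<close> without enumerations\<close>

lemma enumeration:
  assumes "finite A"
  shows "distinct (enumeration A)" "set (enumeration A) = A" "length (enumeration A) = card A"
proof -
  have "\<exists>xs. distinct xs \<and> set xs = A" using finite_distinct_list[OF assms] by blast
  then have "distinct (enumeration A) \<and> set (enumeration A) = A"
    unfolding enumeration_def by (rule someI_ex)
  then show "distinct (enumeration A)" "set (enumeration A) = A" "length (enumeration A) = card A"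
    using distinct_card by force+
qed

lemma bij_betw_enumeration:
  assumes "finite A"
  shows "bij_betw (\<lambda>i. enumeration A ! i) {..<card A} A"
  using enumeration[OF assms] by (intro bij_betw_nth) auto

lemma sum_enumeration:
  assumes "finite A"
  shows "(\<Sum>i<card A. f (enumeration A ! i)) = (\<Sum>a\<in>A. f a)"
  using sum.reindex_bij_betw[OF bij_betw_enumeration[OF assms]] .

text \<open>The squared norm of \<open>T(E,B) v\<close>, with coefficients indexed by the characters
  themselves. In this form no enumeration appears and sums over \<open>B\<close> can be regrouped by
  fibres.\<close>

definition energy :: "'g set \<Rightarrow> ('g \<Rightarrow> complex) set \<Rightarrow> (('g \<Rightarrow> complex) \<Rightarrow> complex) \<Rightarrow> real" where
  "energy E B v = (\<Sum>x\<in>E. (cmod (\<Sum>b\<in>B. v b * b x))\<^sup>2)"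

definition coeff_norm :: "'b set \<Rightarrow> ('b \<Rightarrow> complex) \<Rightarrow> real" where
  "coeff_norm B v = (\<Sum>b\<in>B. (cmod (v b))\<^sup>2)"

lemma coeff_norm_nonneg [simp]: "0 \<le> coeff_norm B v"
  by (simp add: coeff_norm_def sum_nonneg)

lemma char_mat_carrier: "char_mat E B \<in> carrier_mat (card E) (card B)"
  by (simp add: char_mat_def)

definition coeff_vec :: "'b set \<Rightarrow> ('b \<Rightarrow> complex) \<Rightarrow> complex vec" where
  "coeff_vec B v = vec (card B) (\<lambda>j. v (enumeration B ! j))"

lemma coeff_vec_carrier [simp]: "coeff_vec B v \<in> carrier_vec (card B)"
  by (simp add: coeff_vec_def)

lemma ex_coeff_vec:
  assumes "finite B" "u \<in> carrier_vec (card B)"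
  shows "\<exists>v. u = coeff_vec B v"
proof (rule exI, rule eq_vecI)
  \<comment> \<open>Reads the entry of \<open>u\<close> at the position of \<open>b\<close> in the
    enumeration.\<close>
  let ?v = "\<lambda>b. u $ the_inv_into {..<card B} (\<lambda>i. enumeration B ! i) b"
  fix i assume "i < dim_vec (coeff_vec B ?v)"
  then have i: "i < card B" by (simp add: coeff_vec_def)
  then show "u $ i = coeff_vec B ?v $ i"
    using the_inv_into_f_f[OF bij_betw_imp_inj_on[OF bij_betw_enumeration[OF assms(1)]], of i]
    by (simp add: coeff_vec_def)
qed (use assms in \<open>simp add: coeff_vec_def\<close>)

lemma sqnorm_coeff_vec: "finite B \<Longrightarrow> sqnorm (coeff_vec B v) = coeff_norm B v"
  using sum_enumeration[of B "\<lambda>b. (cmod (v b))\<^sup>2"]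
  by (simp add: sqnorm_def coeff_vec_def coeff_norm_def)

lemma sqnorm_char_mat:
  assumes "finite E" "finite B"
  shows "sqnorm (char_mat E B *\<^sub>v coeff_vec B v) = energy E B v"
proof -
  have "(char_mat E B *\<^sub>v coeff_vec B v) $ i = (\<Sum>b\<in>B. v b * b (enumeration E ! i))"
    if "i < card E" for i
  proof -
    have "(char_mat E B *\<^sub>v coeff_vec B v) $ i
        = (\<Sum>j<card B. (enumeration B ! j) (enumeration E ! i) * v (enumeration B ! j))"
      using that by (simp add: char_mat_def coeff_vec_def scalar_prod_def lessThan_atLeast0)
    also have "\<dots> = (\<Sum>b\<in>B. b (enumeration E ! i) * v b)"
      using sum_enumeration[OF assms(2), of "\<lambda>b. b (enumeration E ! i) * v b"] .
    finally show ?thesis by (simp add: mult.commute)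
  qed
  then have "sqnorm (char_mat E B *\<^sub>v coeff_vec B v)
      = (\<Sum>i<card E. (cmod (\<Sum>b\<in>B. v b * b (enumeration E ! i)))\<^sup>2)"
    using char_mat_carrier[of E B] by (simp add: sqnorm_def)
  also have "\<dots> = energy E B v"
    unfolding energy_def using sum_enumeration[OF assms(1)] .
  finally show ?thesis .
qed

lemma L_EB_le:
  assumes "finite E" "finite B" "B \<noteq> {}"
  shows "L_EB E B * coeff_norm B v \<le> energy E B v"
  using sigma_min_le[OF char_mat_carrier _ coeff_vec_carrier, of B E v] assms
  by (simp add: L_EB_def sqnorm_char_mat sqnorm_coeff_vec card_gt_0_iff)

lemma L_EB_attained:
  assumes "finite E" "finite B" "B \<noteq> {}"
  shows "\<exists>v. coeff_norm B v > 0 \<and> energy E B v = L_EB E B * coeff_norm B v"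
proof -
  have c0: "0 < card B" using assms by (simp add: card_gt_0_iff)
  obtain u where u: "u \<in> carrier_vec (card B)" "u \<noteq> 0\<^sub>v (card B)"
      "sqnorm (char_mat E B *\<^sub>v u) = (sigma_min (char_mat E B))\<^sup>2 * sqnorm u"
    using sigma_min_attained[OF char_mat_carrier c0] by blast
  obtain v where v: "u = coeff_vec B v" using ex_coeff_vec[OF assms(2) u(1)] by blast
  have "sqnorm u \<noteq> 0" using sqnorm_eq_0_iff[OF u(1)] u(2) by blast
  then have "sqnorm u > 0" using sqnorm_nonneg[of u] by linarith
  then show ?thesis
    using u(3) assms unfolding v by (auto simp: L_EB_def sqnorm_char_mat sqnorm_coeff_vec)
qed

text \<open>Together with \<open>L_EB_le\<close> this determines \<open>L_EB\<close> as the largest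
  constant below the quotient of \<open>energy\<close> by \<open>coeff_norm\<close>; it follows by
  testing at a minimizing vector.\<close>

lemma L_EB_greatest:
  assumes "finite E" "finite B" "B \<noteq> {}" "\<And>v. c * coeff_norm B v \<le> energy E B v"
  shows "c \<le> L_EB E B"
proof -
  obtain v where "coeff_norm B v > 0" "energy E B v = L_EB E B * coeff_norm B v"
    using L_EB_attained[OF assms(1-3)] by blast
  then show ?thesis using assms(4)[of v] by simp
qed

lemma U_EB_ge:
  assumes "finite E" "finite B" "B \<noteq> {}"
  shows "energy E B v \<le> U_EB E B * coeff_norm B v"
  using op_norm2_ge[OF char_mat_carrier _ coeff_vec_carrier, of B E v] assms
  by (simp add: U_EB_def sqnorm_char_mat sqnorm_coeff_vec card_gt_0_iff)

lemma U_EB_least: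
  assumes "finite E" "finite B" "B \<noteq> {}" "\<And>v. energy E B v \<le> c * coeff_norm B v"
  shows "U_EB E B \<le> c"
  unfolding U_EB_def
proof (rule op_norm2_least[OF char_mat_carrier])
  show "0 < card B" using assms by (simp add: card_gt_0_iff)
  fix u :: "complex vec" assume "u \<in> carrier_vec (card B)"
  then obtain v where "u = coeff_vec B v" using ex_coeff_vec[OF assms(2)] by blast
  then show "sqnorm (char_mat E B *\<^sub>v u) \<le> c * sqnorm u"
    using assms by (simp add: sqnorm_char_mat sqnorm_coeff_vec)
qed

section \<open>Kernels and singularity of \<open>T(E,B)\<close>\<close>

lemma char_mat_kernel_iff:
  assumes "finite E" "finite B"
  shows "(\<exists>u. u \<in> carrier_vec (card B) \<and> u \<noteq> 0\<^sub>v (card B) \<and> char_mat E B *\<^sub>v u = 0\<^sub>v (card E)) \<longleftrightarrow>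
    (\<exists>v. coeff_norm B v \<noteq> 0 \<and> energy E B v = 0)" (is "?l \<longleftrightarrow> ?r")
proof -
  have *: "coeff_vec B v \<noteq> 0\<^sub>v (card B) \<and> char_mat E B *\<^sub>v coeff_vec B v = 0\<^sub>v (card E) \<longleftrightarrow>
      coeff_norm B v \<noteq> 0 \<and> energy E B v = 0" for v
    using sqnorm_eq_0_iff[OF coeff_vec_carrier, of B v] sqnorm_char_mat[OF assms, of v]
      sqnorm_eq_0_iff[of "char_mat E B *\<^sub>v coeff_vec B v" "card E"] char_mat_carrier[of E B]
    by (simp add: sqnorm_coeff_vec[OF assms(2)])
  then show ?thesis using ex_coeff_vec[OF assms(2)] coeff_vec_carrier[of B] by metis
qed

lemma det_char_mat_eq_0_iff:
  assumes "finite E" "finite B" "card B = card E"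
  shows "det (char_mat E B) = 0 \<longleftrightarrow> (\<exists>v. coeff_norm B v \<noteq> 0 \<and> energy E B v = 0)"
proof -
  have "char_mat E B \<in> carrier_mat (card B) (card B)" using char_mat_carrier[of E B] assms(3) by simp
  from det_0_iff_vec_prod_zero[OF this] show ?thesis
    using char_mat_kernel_iff[OF assms(1,2)] assms(3) by simp
qed

text \<open>Padding \<open>A\<close> with zero rows gives a square matrix \<open>P\<close>. Its row
  \<open>r\<close> vanishes, so the transpose kills a unit vector and \<open>det P = 0\<close>; a
  kernel vector of \<open>P\<close> is one of \<open>A\<close>.\<close>

lemma ex_kernel_vec:
  fixes A :: "'a :: field mat"
  assumes A: "A \<in> carrier_mat r n" and rn: "r < n"
  shows "\<exists>u\<in>carrier_vec n. u \<noteq> 0\<^sub>v n \<and> A *\<^sub>v u = 0\<^sub>v r"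
proof -
  define P where "P = mat n n (\<lambda>(i, j). if i < r then A $$ (i, j) else 0)"
  have P: "P \<in> carrier_mat n n" by (simp add: P_def)
  have "transpose_mat P *\<^sub>v unit_vec n r = 0\<^sub>v n"
    using rn P by (intro eq_vecI) (auto simp: P_def)
  moreover have "unit_vec n r \<noteq> (0\<^sub>v n :: 'a vec)"
    using rn by (metis index_unit_vec(2) index_zero_vec(1) zero_neq_one)
  ultimately have "det (transpose_mat P) = 0"
    by (subst det_0_iff_vec_prod_zero[of _ n]) (use P in \<open>auto intro!: exI[of _ "unit_vec n r"]\<close>)
  then have "det P = 0" using det_transpose[OF P] by simp
  then obtain u where u: "u \<in> carrier_vec n" "u \<noteq> 0\<^sub>v n" "P *\<^sub>v u = 0\<^sub>v n"
    using det_0_iff_vec_prod_zero[OF P] by blast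
  have "(A *\<^sub>v u) $ i = 0" if i: "i < r" for i
  proof -
    have "row A i = row P i" using A i rn by (intro eq_vecI) (auto simp: P_def)
    then have "(A *\<^sub>v u) $ i = (P *\<^sub>v u) $ i" using A P i rn by simp
    then show ?thesis using u(3) i rn by simp
  qed
  then have "A *\<^sub>v u = 0\<^sub>v r" using A by (intro eq_vecI) auto
  then show ?thesis using u by blast
qed

lemma ex_energy_eq_0:
  assumes "finite E" "finite B" "card E < card B"
  shows "\<exists>v. coeff_norm B v \<noteq> 0 \<and> energy E B v = 0"
  using ex_kernel_vec[OF char_mat_carrier assms(3)] char_mat_kernel_iff[OF assms(1,2)] by blast

subsection \<open>Determinants indexed by finite sets\<close>

text \<open>The sign of \<open>p\<close> enters once for the rows and once for the columns, and its
  square is \<open>1\<close>.\<close>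

lemma det_permute_rows_cols:
  fixes A :: "'a :: comm_ring_1 mat"
  assumes A: "A \<in> carrier_mat n n" and p: "p permutes {0..<n}"
  shows "det (mat n n (\<lambda>(i, j). A $$ (p i, p j))) = det A"
proof -
  have lt: "p i < n" if "i < n" for i using permutes_in_image[OF p, of i] that by simp
  define C where "C = mat n n (\<lambda>(i, j). A $$ (i, p j))"
  have C: "C \<in> carrier_mat n n" by (simp add: C_def)
  have "mat n n (\<lambda>(i, j). A $$ (p i, p j)) = mat n n (\<lambda>(i, j). C $$ (p i, j))"
    by (intro eq_matI) (auto simp: C_def lt)
  then have "det (mat n n (\<lambda>(i, j). A $$ (p i, p j))) = signof p * det C"
    using det_permute_rows[OF C p] by simp
  also have "det C = det (transpose_mat C)" using det_transpose[OF C] by simp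
  also have "transpose_mat C = mat n n (\<lambda>(i, j). transpose_mat A $$ (p i, j))"
    using A by (intro eq_matI) (auto simp: C_def lt)
  also have "det \<dots> = signof p * det A"
    using det_permute_rows[of "transpose_mat A" n p] A p det_transpose[OF A] by simp
  finally show ?thesis by (simp add: sign_def)
qed

text \<open>A determinant with rows and columns indexed by the same finite set. It is independent of
  the enumeration, so unions and images of index sets can be treated directly.\<close>

definition set_det :: "'b set \<Rightarrow> ('b \<Rightarrow> 'b \<Rightarrow> 'a :: comm_ring_1) \<Rightarrow> 'a" where
  "set_det A f = det (mat (card A) (card A) (\<lambda>(i, j). f (enumeration A ! i) (enumeration A ! j)))"

text \<open>Two enumerations of a set differ by a permutation, which acts on rows and columns
  simultaneously.\<close>

lemma set_det_set:
  assumes "distinct xs"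
  shows "set_det (set xs) f = det (mat (length xs) (length xs) (\<lambda>(i, j). f (xs ! i) (xs ! j)))"
proof -
  let ?n = "length xs" and ?ys = "enumeration (set xs)"
  have ys: "distinct ?ys" "set ?ys = set xs" "length ?ys = ?n"
    using enumeration[of "set xs"] distinct_card[OF assms] by auto
  then have "mset ?ys = mset xs" using assms set_eq_iff_mset_eq_distinct by blast
  then obtain p where p: "p permutes {..<?n}" "permute_list p xs = ?ys"
    using mset_eq_permutation by metis
  have lt: "p i < ?n" if "i < ?n" for i using permutes_in_image[OF p(1), of i] that by simp
  have nth: "?ys ! i = xs ! p i" if "i < ?n" for i
    using permute_list_nth[OF p(1) that] p(2) by simp
  have "mat ?n ?n (\<lambda>(i, j). f (?ys ! i) (?ys ! j))
      = mat ?n ?n (\<lambda>(i, j). mat ?n ?n (\<lambda>(i, j). f (xs ! i) (xs ! j)) $$ (p i, p j))"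
    by (intro eq_matI) (auto simp: nth lt)
  then show ?thesis
    using det_permute_rows_cols[of "mat ?n ?n (\<lambda>(i, j). f (xs ! i) (xs ! j))" ?n p] p(1)
    by (simp add: set_det_def distinct_card[OF assms] lessThan_atLeast0)
qed

lemma set_det_empty [simp]: "set_det {} f = 1"
  by (simp add: set_det_def)

lemma set_det_scale: "set_det A (\<lambda>a b. c * f a b) = c ^ card A * set_det A f"
proof -
  let ?M = "mat (card A) (card A) (\<lambda>(i, j). f (enumeration A ! i) (enumeration A ! j))"
  have "mat (card A) (card A) (\<lambda>(i, j). c * f (enumeration A ! i) (enumeration A ! j)) = c \<cdot>\<^sub>m ?M"
    by (intro eq_matI) auto
  then show ?thesis by (simp add: set_det_def)
qed

lemma set_det_image:
  assumes "finite A" "inj_on g A"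
  shows "set_det (g ` A) f = set_det A (\<lambda>a b. f (g a) (g b))"
proof -
  obtain xs where xs: "distinct xs" "set xs = A" using finite_distinct_list[OF assms(1)] by blast
  have "distinct (map g xs)" using xs assms(2) by (simp add: distinct_map)
  then have "set_det (g ` A) f
      = det (mat (length xs) (length xs) (\<lambda>(i, j). f (map g xs ! i) (map g xs ! j)))"
    using set_det_set[of "map g xs" f] xs by simp
  also have "\<dots> = det (mat (length xs) (length xs) (\<lambda>(i, j). f (g (xs ! i)) (g (xs ! j))))"
    by (intro arg_cong[of _ _ det] eq_matI) auto
  also have "\<dots> = set_det A (\<lambda>a b. f (g a) (g b))"
    using set_det_set[OF xs(1), of "\<lambda>a b. f (g a) (g b)"] xs by simp
  finally show ?thesis .
qed

text \<open>Listing \<open>A\<close> before \<open>C\<close> makes the matrix block lower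
  triangular.\<close>

lemma set_det_Un:
  fixes f :: "'b \<Rightarrow> 'b \<Rightarrow> 'a :: idom"
  assumes "finite A" "finite C" "A \<inter> C = {}"
    and "\<And>a c. a \<in> A \<Longrightarrow> c \<in> C \<Longrightarrow> f a c = 0"
  shows "set_det (A \<union> C) f = set_det A f * set_det C f"
proof -
  obtain xs where xs: "distinct xs" "set xs = A" using finite_distinct_list[OF assms(1)] by blast
  obtain ys where ys: "distinct ys" "set ys = C" using finite_distinct_list[OF assms(2)] by blast
  let ?n = "length xs" and ?m = "length ys"
  have "distinct (xs @ ys)" using xs ys assms(3) by simp
  then have "set_det (A \<union> C) f
      = det (mat (?n + ?m) (?n + ?m) (\<lambda>(i, j). f ((xs @ ys) ! i) ((xs @ ys) ! j)))"
    using set_det_set[of "xs @ ys" f] xs ys by simp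
  also have "mat (?n + ?m) (?n + ?m) (\<lambda>(i, j). f ((xs @ ys) ! i) ((xs @ ys) ! j))
      = four_block_mat (mat ?n ?n (\<lambda>(i, j). f (xs ! i) (xs ! j))) (0\<^sub>m ?n ?m)
          (mat ?m ?n (\<lambda>(i, j). f (ys ! i) (xs ! j))) (mat ?m ?m (\<lambda>(i, j). f (ys ! i) (ys ! j)))"
  proof (intro eq_matI)
    fix i j assume "i < dim_row (four_block_mat (mat ?n ?n (\<lambda>(i, j). f (xs ! i) (xs ! j))) (0\<^sub>m ?n ?m)
          (mat ?m ?n (\<lambda>(i, j). f (ys ! i) (xs ! j))) (mat ?m ?m (\<lambda>(i, j). f (ys ! i) (ys ! j))))"
      "j < dim_col (four_block_mat (mat ?n ?n (\<lambda>(i, j). f (xs ! i) (xs ! j))) (0\<^sub>m ?n ?m)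
          (mat ?m ?n (\<lambda>(i, j). f (ys ! i) (xs ! j))) (mat ?m ?m (\<lambda>(i, j). f (ys ! i) (ys ! j))))"
    then have ij: "i < ?n + ?m" "j < ?n + ?m" by auto
    have "f (xs ! i) (ys ! (j - ?n)) = 0" if "i < ?n" "\<not> j < ?n"
      using assms(4)[of "xs ! i" "ys ! (j - ?n)"] that xs ys ij by force
    then show "mat (?n + ?m) (?n + ?m) (\<lambda>(i, j). f ((xs @ ys) ! i) ((xs @ ys) ! j)) $$ (i, j)
      = four_block_mat (mat ?n ?n (\<lambda>(i, j). f (xs ! i) (xs ! j))) (0\<^sub>m ?n ?m)
          (mat ?m ?n (\<lambda>(i, j). f (ys ! i) (xs ! j))) (mat ?m ?m (\<lambda>(i, j). f (ys ! i) (ys ! j))) $$ (i, j)"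
      using ij by (auto simp: nth_append)
  qed auto
  also have "det \<dots> = set_det A f * set_det C f"
    using set_det_set[OF xs(1), of f] set_det_set[OF ys(1), of f] xs ys
    by (subst det_four_block_mat_upper_right_zero[of _ ?n _ ?m]) auto
  finally show ?thesis .
qed

lemma set_det_UNION:
  fixes f :: "'b \<Rightarrow> 'b \<Rightarrow> 'a :: idom"
  assumes "finite I" "\<And>i. i \<in> I \<Longrightarrow> finite (A i)"
    and "\<And>i j. i \<in> I \<Longrightarrow> j \<in> I \<Longrightarrow> i \<noteq> j \<Longrightarrow> A i \<inter> A j = {}"
    and "\<And>i j a c. i \<in> I \<Longrightarrow> j \<in> I \<Longrightarrow> i \<noteq> j \<Longrightarrow> a \<in> A i \<Longrightarrow> c \<in> A j \<Longrightarrow> f a c = 0"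
  shows "set_det (\<Union>i\<in>I. A i) f = (\<Prod>i\<in>I. set_det (A i) f)"
  using assms
proof (induction I rule: finite_induct)
  case (insert k I)
  have "set_det (A k \<union> (\<Union>i\<in>I. A i)) f = set_det (A k) f * set_det (\<Union>i\<in>I. A i) f"
  proof (rule set_det_Un)
    show "finite (A k)" "finite (\<Union>i\<in>I. A i)" using insert by auto
    show "A k \<inter> (\<Union>i\<in>I. A i) = {}" using insert.prems(2)[of k] insert.hyps(2) by fastforce
    show "f a c = 0" if "a \<in> A k" "c \<in> (\<Union>i\<in>I. A i)" for a c
      using insert.prems(3)[of k _ a c] insert.hyps(2) that by fastforce
  qed
  also have "set_det (\<Union>i\<in>I. A i) f = (\<Prod>i\<in>I. set_det (A i) f)"
    using insert.prems by (intro insert.IH) blast+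
  finally show ?case using insert.hyps by simp
qed simp

subsection \<open>Gram determinants and fibres of character sets\<close>

text \<open>The entry of \<open>T\<^sup>* T\<close> at a pair of characters, where \<open>T\<close>
  has a column for each character.\<close>

definition gram :: "'g set \<Rightarrow> ('g \<Rightarrow> complex) \<Rightarrow> ('g \<Rightarrow> complex) \<Rightarrow> complex" where
  "gram E b b' = (\<Sum>x\<in>E. cnj (b x) * b' x)"

text \<open>\<open>det (T\<^sup>* T)\<close> is the squared modulus of \<open>det T\<close>.
  Squaring removes the enumeration of \<open>E\<close> and leaves a determinant indexed by
  \<open>B\<close> alone, to which block decompositions apply.\<close>

lemma D_EB_square:
  assumes "finite E" "finite B" "card B = card E"
  shows "complex_of_real ((D_EB E B)\<^sup>2) = set_det B (gram E)"
proof -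
  interpret cnj: comm_ring_hom cnj by unfold_locales auto
  let ?n = "card E" and ?T = "char_mat E B"
  have T: "?T \<in> carrier_mat ?n ?n" using char_mat_carrier[of E B] assms(3) by simp
  have "mat ?n ?n (\<lambda>(i, j). gram E (enumeration B ! i) (enumeration B ! j))
      = transpose_mat (map_mat cnj ?T) * ?T"
  proof (intro eq_matI)
    fix i j assume "i < dim_row (transpose_mat (map_mat cnj ?T) * ?T)"
      "j < dim_col (transpose_mat (map_mat cnj ?T) * ?T)"
    then have ij: "i < ?n" "j < ?n" using T by auto
    have "gram E (enumeration B ! i) (enumeration B ! j)
        = (\<Sum>k<?n. cnj ((enumeration B ! i) (enumeration E ! k)) *
            (enumeration B ! j) (enumeration E ! k))"
      unfolding gram_def
      by (rule sum_enumeration[OF assms(1), symmetric,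
            of "\<lambda>x. cnj ((enumeration B ! i) x) * (enumeration B ! j) x"])
    then show "mat ?n ?n (\<lambda>(i, j). gram E (enumeration B ! i) (enumeration B ! j)) $$ (i, j)
        = (transpose_mat (map_mat cnj ?T) * ?T) $$ (i, j)"
      using ij T assms(3) by (simp add: scalar_prod_def char_mat_def lessThan_atLeast0)
  qed (use T in auto)
  then have "set_det B (gram E) = cnj (det ?T) * det ?T"
    using T by (simp add: set_det_def assms(3) det_mult[of _ ?n] det_transpose[of _ ?n])
  then show ?thesis by (simp add: D_EB_def complex_norm_square mult.commute del: of_real_power)
qed

section \<open>Characters of a product group and fibres\<close>

definition char_prod :: "('h \<Rightarrow> complex) \<Rightarrow> ('k \<Rightarrow> complex) \<Rightarrow> 'h \<times> 'k \<Rightarrow> complex" where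
  "char_prod \<chi> \<psi> = (\<lambda>(x, k). \<chi> x * \<psi> k)"

text \<open>The condition \<open>\<chi> \<in> dual\<close> makes every fibre finite, whatever
  \<open>B\<close> is.\<close>

definition fiber ::
  "('h :: {finite, ab_group_add} \<times> 'k \<Rightarrow> complex) set \<Rightarrow> ('k \<Rightarrow> complex) \<Rightarrow> ('h \<Rightarrow> complex) set" where
  "fiber B \<psi> = {\<chi> \<in> dual. char_prod \<chi> \<psi> \<in> B}"

lemma char_prod_dual: "\<chi> \<in> dual \<Longrightarrow> \<psi> \<in> dual \<Longrightarrow> char_prod \<chi> \<psi> \<in> dual"
  by (auto simp: dual_def char_prod_def norm_mult)

lemma char_prod_inj:
  assumes "\<chi> \<in> dual" "\<psi> \<in> dual" "\<chi>' \<in> dual" "\<psi>' \<in> dual"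
  shows "char_prod \<chi> \<psi> = char_prod \<chi>' \<psi>' \<longleftrightarrow> \<chi> = \<chi>' \<and> \<psi> = \<psi>'"
proof
  assume eq: "char_prod \<chi> \<psi> = char_prod \<chi>' \<psi>'"
  have "\<chi> x = \<chi>' x" for x
    using fun_cong[OF eq, of "(x, 0)"] assms by (simp add: char_prod_def dual_zero)
  moreover have "\<psi> k = \<psi>' k" for k
    using fun_cong[OF eq, of "(0, k)"] assms by (simp add: char_prod_def dual_zero)
  ultimately show "\<chi> = \<chi>' \<and> \<psi> = \<psi>'" by auto
qed auto

text \<open>Every pair splits as \<open>(x, 0) + (0, k)\<close>, so a character is the product of
  its two restrictions.\<close>

lemma dual_eq_char_prod:
  fixes b :: "'h :: {finite, ab_group_add} \<times> 'k :: {finite, ab_group_add} \<Rightarrow> complex"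
  assumes "b \<in> dual"
  shows "\<exists>\<chi>\<in>dual. \<exists>\<psi>\<in>dual. b = char_prod \<chi> \<psi>"
proof (intro bexI)
  show "b = char_prod (\<lambda>x. b (x, 0)) (\<lambda>k. b (0, k))"
  proof
    fix z
    show "b z = char_prod (\<lambda>x. b (x, 0)) (\<lambda>k. b (0, k)) z"
      using dual_add[OF assms, of "(fst z, 0)" "(0, snd z)"] by (cases z) (simp add: char_prod_def)
  qed
  show "(\<lambda>x. b (x, 0)) \<in> dual"
    using dual_norm[OF assms] dual_add[OF assms, of "(_, 0)" "(_, 0)"] by (simp add: dual_def)
  show "(\<lambda>k. b (0, k)) \<in> dual"
    using dual_norm[OF assms] dual_add[OF assms, of "(0, _)" "(0, _)"] by (simp add: dual_def)
qed

lemma finite_subset_dual: "B \<subseteq> dual \<Longrightarrow> finite B"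
  using finite_dual finite_subset by blast

lemma fiber_subset_dual: "fiber B \<psi> \<subseteq> dual"
  by (auto simp: fiber_def)

lemma finite_fiber: "finite (fiber B \<psi>)"
  using finite_subset_dual[OF fiber_subset_dual] .

lemma Union_fibers:
  fixes B :: "('h :: {finite, ab_group_add} \<times> 'k :: {finite, ab_group_add} \<Rightarrow> complex) set"
  assumes "B \<subseteq> dual"
  shows "B = (\<Union>\<psi>\<in>dual. (\<lambda>\<chi>. char_prod \<chi> \<psi>) ` fiber B \<psi>)"
proof
  show "B \<subseteq> (\<Union>\<psi>\<in>dual. (\<lambda>\<chi>. char_prod \<chi> \<psi>) ` fiber B \<psi>)"
  proof
    fix b assume "b \<in> B"
    then obtain \<chi> \<psi> where "\<chi> \<in> dual" "\<psi> \<in> dual" "b = char_prod \<chi> \<psi>"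
      using dual_eq_char_prod assms by blast
    then show "b \<in> (\<Union>\<psi>\<in>dual. (\<lambda>\<chi>. char_prod \<chi> \<psi>) ` fiber B \<psi>)"
      using \<open>b \<in> B\<close> by (auto simp: fiber_def)
  qed
qed (auto simp: fiber_def)

lemma inj_on_char_prod_fiber: "\<psi> \<in> dual \<Longrightarrow> inj_on (\<lambda>\<chi>. char_prod \<chi> \<psi>) (fiber B \<psi>)"
  by (auto simp: inj_on_def fiber_def char_prod_inj)

lemma disjoint_fibers:
  "\<psi> \<in> dual \<Longrightarrow> \<phi> \<in> dual \<Longrightarrow> \<psi> \<noteq> \<phi> \<Longrightarrow>
    (\<lambda>\<chi>. char_prod \<chi> \<psi>) ` fiber B \<psi> \<inter> (\<lambda>\<chi>. char_prod \<chi> \<phi>) ` fiber B \<phi> = {}"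
  by (auto simp: fiber_def char_prod_inj)

lemma sum_fibers:
  fixes B :: "('h :: {finite, ab_group_add} \<times> 'k :: {finite, ab_group_add} \<Rightarrow> complex) set"
    and f :: "_ \<Rightarrow> 'c :: comm_monoid_add"
  assumes "B \<subseteq> dual"
  shows "(\<Sum>b\<in>B. f b) = (\<Sum>\<psi>\<in>dual. \<Sum>\<chi>\<in>fiber B \<psi>. f (char_prod \<chi> \<psi>))"
proof -
  have "(\<Sum>b\<in>B. f b) = (\<Sum>b\<in>(\<Union>\<psi>\<in>dual. (\<lambda>\<chi>. char_prod \<chi> \<psi>) ` fiber B \<psi>). f b)"
    using Union_fibers[OF assms] by simp
  also have "\<dots> = (\<Sum>\<psi>\<in>dual. \<Sum>b\<in>(\<lambda>\<chi>. char_prod \<chi> \<psi>) ` fiber B \<psi>. f b)"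
    by (rule sum.UNION_disjoint) (auto simp: finite_dual finite_fiber disjoint_fibers simp del: Int_iff)
  also have "\<dots> = (\<Sum>\<psi>\<in>dual. \<Sum>\<chi>\<in>fiber B \<psi>. f (char_prod \<chi> \<psi>))"
    by (intro sum.cong refl) (simp add: sum.reindex inj_on_char_prod_fiber)
  finally show ?thesis .
qed

lemma card_eq_sum_fibers:
  fixes B :: "('h :: {finite, ab_group_add} \<times> 'k :: {finite, ab_group_add} \<Rightarrow> complex) set"
  assumes "B \<subseteq> dual"
  shows "card B = (\<Sum>\<psi>\<in>dual. card (fiber B \<psi>))"
  using sum_fibers[OF assms, of "\<lambda>_. 1 :: nat"] by simp

text \<open>Expanding the square and summing over the group first leaves only the diagonal terms, by
  orthogonality of characters.\<close>

lemma parseval: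
  fixes a :: "('k :: {finite, ab_group_add} \<Rightarrow> complex) \<Rightarrow> complex"
  shows "(\<Sum>k\<in>UNIV. (cmod (\<Sum>\<psi>\<in>dual. a \<psi> * \<psi> k))\<^sup>2)
    = real (card (UNIV :: 'k set)) * (\<Sum>\<psi>\<in>dual. (cmod (a \<psi>))\<^sup>2)"
proof -
  let ?m = "of_nat (card (UNIV :: 'k set)) :: complex"
  have "complex_of_real (\<Sum>k\<in>UNIV. (cmod (\<Sum>\<psi>\<in>dual. a \<psi> * \<psi> k))\<^sup>2)
      = (\<Sum>k\<in>UNIV. (\<Sum>\<psi>\<in>dual. a \<psi> * \<psi> k) * cnj (\<Sum>\<psi>\<in>dual. a \<psi> * \<psi> k))"
    by (simp only: of_real_sum complex_norm_square)
  also have "\<dots> = (\<Sum>k\<in>UNIV. \<Sum>\<psi>\<in>dual. \<Sum>\<phi>\<in>dual. a \<psi> * cnj (a \<phi>) * (cnj (\<phi> k) * \<psi> k))"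
    by (simp add: sum_product mult_ac)
  also have "\<dots> = (\<Sum>\<psi>\<in>dual. \<Sum>\<phi>\<in>dual. \<Sum>k\<in>UNIV. a \<psi> * cnj (a \<phi>) * (cnj (\<phi> k) * \<psi> k))"
    by (subst sum.swap, intro sum.cong refl, rule sum.swap)
  also have "\<dots> = (\<Sum>\<psi>\<in>dual. \<Sum>\<phi>\<in>dual. if \<phi> = \<psi> then a \<psi> * cnj (a \<phi>) * ?m else 0)"
    by (intro sum.cong refl) (simp add: dual_orthogonal flip: sum_distrib_left)
  also have "\<dots> = (\<Sum>\<psi>\<in>dual. ?m * (a \<psi> * cnj (a \<psi>)))"
    by (intro sum.cong refl) (simp add: finite_dual sum.delta mult.commute)
  also have "\<dots> = complex_of_real (real (card (UNIV :: 'k set)) * (\<Sum>\<psi>\<in>dual. (cmod (a \<psi>))\<^sup>2))"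
    by (simp add: sum_distrib_left complex_norm_square del: of_real_power)
  finally show ?thesis by (simp only: of_real_eq_iff)
qed

text \<open>For fixed \<open>x\<close> the inner sum, regrouped by fibres, is a combination of the
  characters \<open>\<psi>\<close> with coefficients \<open>a x \<psi>\<close>, so Parseval
  evaluates the sum over \<open>k\<close>.\<close>

lemma energy_times_UNIV:
  fixes B :: "('h :: {finite, ab_group_add} \<times> 'k :: {finite, ab_group_add} \<Rightarrow> complex) set"
  assumes "B \<subseteq> dual"
  shows "energy (E1 \<times> UNIV) B v = real (card (UNIV :: 'k set)) *
    (\<Sum>\<psi>\<in>dual. energy E1 (fiber B \<psi>) (\<lambda>\<chi>. v (char_prod \<chi> \<psi>)))"
proof -
  define a where "a = (\<lambda>x \<psi>. \<Sum>\<chi>\<in>fiber B \<psi>. v (char_prod \<chi> \<psi>) * \<chi> x)"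
  have "(\<Sum>b\<in>B. v b * b (x, k)) = (\<Sum>\<psi>\<in>dual. a x \<psi> * \<psi> k)" for x k
    unfolding sum_fibers[OF assms]
    by (simp add: a_def char_prod_def sum_distrib_right mult.assoc)
  then have "energy (E1 \<times> UNIV) B v = (\<Sum>x\<in>E1. \<Sum>k\<in>UNIV. (cmod (\<Sum>\<psi>\<in>dual. a x \<psi> * \<psi> k))\<^sup>2)"
    by (auto simp: energy_def sum.cartesian_product intro!: sum.cong)
  also have "\<dots> = real (card (UNIV :: 'k set)) * (\<Sum>x\<in>E1. \<Sum>\<psi>\<in>dual. (cmod (a x \<psi>))\<^sup>2)"
    unfolding parseval by (simp add: sum_distrib_left)
  also have "(\<Sum>x\<in>E1. \<Sum>\<psi>\<in>dual. (cmod (a x \<psi>))\<^sup>2)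
      = (\<Sum>\<psi>\<in>dual. energy E1 (fiber B \<psi>) (\<lambda>\<chi>. v (char_prod \<chi> \<psi>)))"
    unfolding energy_def a_def by (rule sum.swap)
  finally show ?thesis .
qed

lemma coeff_norm_fibers:
  fixes B :: "('h :: {finite, ab_group_add} \<times> 'k :: {finite, ab_group_add} \<Rightarrow> complex) set"
  assumes "B \<subseteq> dual"
  shows "coeff_norm B v = (\<Sum>\<psi>\<in>dual. coeff_norm (fiber B \<psi>) (\<lambda>\<chi>. v (char_prod \<chi> \<psi>)))"
  unfolding coeff_norm_def by (rule sum_fibers[OF assms])

lemma gram_times_UNIV:
  fixes \<psi> :: "'k :: {finite, ab_group_add} \<Rightarrow> complex"
  assumes "\<psi> \<in> dual" "\<psi>' \<in> dual"
  shows "gram (E1 \<times> UNIV) (char_prod \<chi> \<psi>) (char_prod \<chi>' \<psi>')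
    = (if \<psi> = \<psi>' then of_nat (card (UNIV :: 'k set)) * gram E1 \<chi> \<chi>' else 0)"
proof -
  have "gram (E1 \<times> UNIV) (char_prod \<chi> \<psi>) (char_prod \<chi>' \<psi>')
      = (\<Sum>x\<in>E1. \<Sum>k\<in>UNIV. (cnj (\<chi> x) * \<chi>' x) * (cnj (\<psi> k) * \<psi>' k))"
    by (simp add: gram_def char_prod_def sum.cartesian_product case_prod_unfold mult_ac)
  also have "\<dots> = gram E1 \<chi> \<chi>' * (\<Sum>k\<in>UNIV. cnj (\<psi> k) * \<psi>' k)"
    by (simp add: gram_def sum_product)
  finally show ?thesis unfolding dual_orthogonal[OF assms] by simp
qed

text \<open>Extension by zero: a vector supported on part of one fibre becomes a test vector for the
  whole of \<open>B\<close>.\<close>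

lemma extend_coefficients_from_fiber:
  fixes B :: "('h :: {finite, ab_group_add} \<times> 'k :: {finite, ab_group_add} \<Rightarrow> complex) set"
  assumes "B \<subseteq> dual" "\<psi> \<in> dual" "B' \<subseteq> fiber B \<psi>"
  shows "\<exists>w. coeff_norm B w = coeff_norm B' v \<and>
    energy (E1 \<times> UNIV) B w = real (card (UNIV :: 'k set)) * energy E1 B' v"
proof -
  \<comment> \<open>Since \<open>\<psi> 0 = 1\<close>, restriction to \<open>(x, 0)\<close> recovers
    \<open>\<chi>\<close> from \<open>char_prod \<chi> \<psi>\<close>.\<close>
  define w where "w = (\<lambda>b. if b \<in> (\<lambda>\<chi>. char_prod \<chi> \<psi>) ` B' then v (\<lambda>x. b (x, 0)) else 0)"
  have w: "w (char_prod \<chi> \<phi>) = (if \<phi> = \<psi> \<and> \<chi> \<in> B' then v \<chi> else 0)"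
    if "\<chi> \<in> fiber B \<phi>" "\<phi> \<in> dual" for \<chi> \<phi>
  proof -
    have dual: "\<chi> \<in> dual" "B' \<subseteq> dual" using that assms(3) fiber_subset_dual by blast+
    then have "char_prod \<chi> \<phi> \<in> (\<lambda>\<chi>. char_prod \<chi> \<psi>) ` B' \<longleftrightarrow> \<phi> = \<psi> \<and> \<chi> \<in> B'"
      using that(2) assms(2) by (auto simp: subset_iff char_prod_inj)
    moreover have "(\<lambda>x. char_prod \<chi> \<phi> (x, 0)) = \<chi>"
      using that(2) by (simp add: char_prod_def dual_zero)
    ultimately show ?thesis by (auto simp: w_def)
  qed
  have c: "coeff_norm (fiber B \<phi>) (\<lambda>\<chi>. w (char_prod \<chi> \<phi>)) = (if \<phi> = \<psi> then coeff_norm B' v else 0)"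
    if "\<phi> \<in> dual" for \<phi>
  proof (cases "\<phi> = \<psi>")
    case True
    have "(\<Sum>\<chi>\<in>fiber B \<psi>. (cmod (w (char_prod \<chi> \<psi>)))\<^sup>2) = (\<Sum>\<chi>\<in>B'. (cmod (v \<chi>))\<^sup>2)"
      using assms by (intro sum.mono_neutral_cong_right) (auto simp: finite_fiber w)
    then show ?thesis using True by (simp add: coeff_norm_def)
  qed (use that in \<open>simp add: coeff_norm_def w\<close>)
  have e: "energy E1 (fiber B \<phi>) (\<lambda>\<chi>. w (char_prod \<chi> \<phi>)) = (if \<phi> = \<psi> then energy E1 B' v else 0)"
    if "\<phi> \<in> dual" for \<phi>
  proof (cases "\<phi> = \<psi>")
    case True
    have "(\<Sum>\<chi>\<in>fiber B \<psi>. w (char_prod \<chi> \<psi>) * \<chi> x) = (\<Sum>\<chi>\<in>B'. v \<chi> * \<chi> x)" for x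
      using assms by (intro sum.mono_neutral_cong_right) (auto simp: finite_fiber w)
    then show ?thesis using True by (simp add: energy_def)
  qed (use that in \<open>simp add: energy_def w\<close>)
  have "coeff_norm B w = coeff_norm B' v"
    unfolding coeff_norm_fibers[OF assms(1)] using c assms(2) by (simp add: sum.delta finite_dual)
  moreover have "energy (E1 \<times> UNIV) B w = real (card (UNIV :: 'k set)) * energy E1 B' v"
    unfolding energy_times_UNIV[OF assms(1)] using e assms(2) by (simp add: sum.delta finite_dual)
  ultimately show ?thesis by blast
qed

text \<open>Up to the factor \<open>|K|\<close>, the form of \<open>B'\<close> is a restriction of
  the form of \<open>B\<close>. Restricting raises the minimum of the quotient and lowers the
  maximum.\<close>

lemma L_U_fiber:
  fixes B :: "('h :: {finite, ab_group_add} \<times> 'k :: {finite, ab_group_add} \<Rightarrow> complex) set"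
  assumes "B \<subseteq> dual" "\<psi> \<in> dual" "B' \<subseteq> fiber B \<psi>" "B' \<noteq> {}"
  shows "L_EB (E1 \<times> UNIV) B \<le> real (card (UNIV :: 'k set)) * L_EB E1 B'"
    and "real (card (UNIV :: 'k set)) * U_EB E1 B' \<le> U_EB (E1 \<times> UNIV) B"
proof -
  let ?m = "real (card (UNIV :: 'k set))"
  have m: "?m > 0" by (simp add: card_gt_0_iff)
  have fin: "finite B" "finite B'"
    using finite_subset_dual[OF assms(1)] finite_subset[OF assms(3) finite_fiber] .
  have ne: "B \<noteq> {}" using assms(3,4) by (auto simp: fiber_def)
  have "L_EB (E1 \<times> UNIV) B / ?m \<le> L_EB E1 B'"
  proof (rule L_EB_greatest)
    fix v
    obtain w where w: "coeff_norm B w = coeff_norm B' v"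
        "energy (E1 \<times> UNIV) B w = ?m * energy E1 B' v"
      using extend_coefficients_from_fiber[OF assms(1-3)] by blast
    have "L_EB (E1 \<times> UNIV) B * coeff_norm B' v \<le> ?m * energy E1 B' v"
      using L_EB_le[of "E1 \<times> UNIV" B w] w fin ne by simp
    then show "L_EB (E1 \<times> UNIV) B / ?m * coeff_norm B' v \<le> energy E1 B' v"
      using m by (simp add: field_simps)
  qed (use fin assms in auto)
  then show "L_EB (E1 \<times> UNIV) B \<le> ?m * L_EB E1 B'" using m by (simp add: field_simps)
  have "U_EB E1 B' \<le> U_EB (E1 \<times> UNIV) B / ?m"
  proof (rule U_EB_least)
    fix v
    obtain w where w: "coeff_norm B w = coeff_norm B' v"
        "energy (E1 \<times> UNIV) B w = ?m * energy E1 B' v"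
      using extend_coefficients_from_fiber[OF assms(1-3)] by blast
    have "?m * energy E1 B' v \<le> U_EB (E1 \<times> UNIV) B * coeff_norm B' v"
      using U_EB_ge[of "E1 \<times> UNIV" B w] w fin ne by simp
    then show "energy E1 B' v \<le> U_EB (E1 \<times> UNIV) B / ?m * coeff_norm B' v"
      using m by (simp add: field_simps)
  qed (use fin assms in auto)
  then show "?m * U_EB E1 B' \<le> U_EB (E1 \<times> UNIV) B" using m by (simp add: field_simps)
qed

text \<open>Pigeonhole: there are as many fibres as elements of \<open>K\<close>, so they cannot all
  be smaller than \<open>n\<close>.\<close>

lemma ex_large_fiber:
  fixes B :: "('h :: {finite, ab_group_add} \<times> 'k :: {finite, ab_group_add} \<Rightarrow> complex) set"
  assumes "B \<subseteq> dual" "card B = n * card (UNIV :: 'k set)"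
  shows "\<exists>\<psi>\<in>dual. \<exists>B'\<subseteq>fiber B \<psi>. card B' = n"
proof -
  have "\<exists>\<psi>\<in>dual. n \<le> card (fiber B \<psi>)"
  proof (rule ccontr)
    assume "\<not> ?thesis"
    then have lt: "\<forall>\<psi>\<in>dual. card (fiber B \<psi>) < n" by force
    have "(\<Sum>\<psi>\<in>(dual :: ('k \<Rightarrow> complex) set). card (fiber B \<psi>)) < (\<Sum>\<psi>\<in>(dual :: ('k \<Rightarrow> complex) set). n)"
      using lt finite_dual dual_one by (intro sum_strict_mono) auto
    then show False
      using card_eq_sum_fibers[OF assms(1)] assms(2) card_dual[where 'a = 'k] by (simp add: mult.commute)
  qed
  then show ?thesis by (meson obtain_subset_with_card_n)
qed

definition lift_chars :: "('h \<Rightarrow> complex) set \<Rightarrow> ('h \<times> 'k :: {finite, ab_group_add} \<Rightarrow> complex) set" where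
  "lift_chars B1 = (\<lambda>(\<chi>, \<psi>). char_prod \<chi> \<psi>) ` (B1 \<times> dual)"

lemma mem_lift_chars: "b \<in> lift_chars B1 \<longleftrightarrow> (\<exists>\<chi>\<in>B1. \<exists>\<psi>\<in>dual. b = char_prod \<chi> \<psi>)"
  by (auto simp: lift_chars_def)

lemma lift_chars_dual: "B1 \<subseteq> dual \<Longrightarrow> lift_chars B1 \<subseteq> dual"
  by (auto simp: lift_chars_def intro!: char_prod_dual)

lemma fiber_lift_chars: "B1 \<subseteq> dual \<Longrightarrow> \<psi> \<in> dual \<Longrightarrow> fiber (lift_chars B1) \<psi> = B1"
  by (auto simp: fiber_def lift_chars_def char_prod_inj subset_iff)

lemma card_lift_chars:
  assumes "B1 \<subseteq> dual"
  shows "card (lift_chars B1 ::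
      ('h :: {finite, ab_group_add} \<times> 'k :: {finite, ab_group_add} \<Rightarrow> complex) set)
    = card B1 * card (UNIV :: 'k set)"
  using assms by (subst card_eq_sum_fibers[OF lift_chars_dual[OF assms]])
    (simp add: fiber_lift_chars card_dual mult.commute)

text \<open>The form of the lifted set is \<open>|K|\<close> times an orthogonal sum of copies of
  the form of \<open>B1\<close>, so the extreme bounds hold summand by summand.\<close>

lemma L_U_lift_chars:
  fixes B1 :: "('h :: {finite, ab_group_add} \<Rightarrow> complex) set"
    and B :: "('h \<times> 'k :: {finite, ab_group_add} \<Rightarrow> complex) set"
  assumes "B1 \<subseteq> dual" "B1 \<noteq> {}" and B: "B = lift_chars B1"
  shows "real (card (UNIV :: 'k set)) * L_EB E1 B1 \<le> L_EB (E1 \<times> UNIV) B"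
    and "U_EB (E1 \<times> UNIV) B \<le> real (card (UNIV :: 'k set)) * U_EB E1 B1"
proof -
  let ?m = "real (card (UNIV :: 'k set))"
  have sub: "B \<subseteq> dual" unfolding B by (rule lift_chars_dual[OF assms(1)])
  have fin: "finite B" "finite B1" using finite_subset_dual sub assms(1) by blast+
  have ne: "B \<noteq> {}" using assms(2) dual_one unfolding B lift_chars_def by blast
  have e: "energy (E1 \<times> UNIV) B v = ?m * (\<Sum>\<psi>\<in>dual. energy E1 B1 (\<lambda>\<chi>. v (char_prod \<chi> \<psi>)))" for v
    using energy_times_UNIV[OF sub, of E1 v] assms(1) unfolding B by (simp add: fiber_lift_chars)
  have c: "coeff_norm B v = (\<Sum>\<psi>\<in>dual. coeff_norm B1 (\<lambda>\<chi>. v (char_prod \<chi> \<psi>)))" for v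
    using coeff_norm_fibers[OF sub, of v] assms(1) unfolding B by (simp add: fiber_lift_chars)
  show "?m * L_EB E1 B1 \<le> L_EB (E1 \<times> UNIV) B"
    by (rule L_EB_greatest)
       (use fin ne assms(1,2) in \<open>auto simp: e c sum_distrib_left mult.assoc
         intro!: sum_mono mult_left_mono L_EB_le\<close>)
  show "U_EB (E1 \<times> UNIV) B \<le> ?m * U_EB E1 B1"
    by (rule U_EB_least)
       (use fin ne assms(1,2) in \<open>auto simp: e c sum_distrib_left mult.assoc
         intro!: sum_mono mult_left_mono U_EB_ge\<close>)
qed

text \<open>Both sides say that no nonzero coefficient vector has zero energy. This links the
  convention \<open>\<infinity>\<close> for singular matrices to the bounds on
  \<open>L_EB\<close>.\<close>

lemma det_char_mat_ne_0_iff: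
  assumes "finite E" "finite B" "B \<noteq> {}" "card B = card E"
  shows "det (char_mat E B) \<noteq> 0 \<longleftrightarrow> L_EB E B > 0"
proof
  assume "det (char_mat E B) \<noteq> 0"
  then have "energy E B v \<noteq> 0" if "coeff_norm B v > 0" for v
    using that det_char_mat_eq_0_iff[OF assms(1,2,4)] by force
  moreover obtain v where "coeff_norm B v > 0" "energy E B v = L_EB E B * coeff_norm B v"
    using L_EB_attained[OF assms(1-3)] by blast
  ultimately have "L_EB E B \<noteq> 0" by force
  then show "L_EB E B > 0" by (simp add: L_EB_def)
next
  assume L: "L_EB E B > 0"
  have "coeff_norm B v = 0" if "energy E B v = 0" for v
  proof -
    have "L_EB E B * coeff_norm B v \<le> 0" using L_EB_le[OF assms(1-3), of v] that by simp
    then show ?thesis using L coeff_norm_nonneg[of B v] by (simp add: mult_le_0_iff)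
  qed
  then show "det (char_mat E B) \<noteq> 0"
    using det_char_mat_eq_0_iff[OF assms(1,2,4)] by blast
qed

text \<open>Here \<open>c\<close> is the ratio of the sizes. It is applied with
  \<open>c = |K|\<close> to pass from \<open>E1\<close> to the product and with
  \<open>c = 1 / |K|\<close> to pass back.\<close>

lemma norm_quantities_mono:
  assumes fin: "finite E" "finite B" "finite E'" "finite B'" and ne: "E' \<noteq> {}"
    and c: "0 < c" and card: "real (card E) = c * real (card E')" "card B = card E" "card B' = card E'"
    and L: "c * L_EB E' B' \<le> L_EB E B" and U: "U_EB E B \<le> c * U_EB E' B'"
  shows "norm_L_EB E B \<le> norm_L_EB E' B'" "norm_U_EB E B \<le> norm_U_EB E' B'" "rho_EB E B \<le> rho_EB E' B'"
proof -
  have n: "card E' > 0" using ne fin by (simp add: card_gt_0_iff)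
  then have "card E > 0" using card(1) c by (metis mult_pos_pos of_nat_0_less_iff)
  then have nonempty: "B \<noteq> {}" "B' \<noteq> {}" using card(2,3) n by auto
  note det = det_char_mat_ne_0_iff[OF fin(1,2) nonempty(1) card(2)]
    det_char_mat_ne_0_iff[OF fin(3,4) nonempty(2) card(3)]
  show "norm_U_EB E B \<le> norm_U_EB E' B'"
    using U c n by (simp add: norm_U_EB_def card(1) field_simps)
  \<comment> \<open>Nonsingularity passes from \<open>B'\<close> to \<open>B\<close>, so a finite
    right side never faces \<open>\<infinity>\<close> on the left.\<close>
  have L_pos: "L_EB E B > 0" if "L_EB E' B' > 0"
    using L mult_pos_pos[OF c that] by linarith
  show "norm_L_EB E B \<le> norm_L_EB E' B'"
  proof (cases "det (char_mat E' B') = 0")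
    case False
    then have pos: "L_EB E' B' > 0" "L_EB E B > 0" "det (char_mat E B) \<noteq> 0" using det L_pos by auto
    have "real (card E) / L_EB E B \<le> real (card E) / (c * L_EB E' B')"
      using L pos c by (intro divide_left_mono) auto
    also have "\<dots> = real (card E') / L_EB E' B'" using c card(1) by simp
    finally show ?thesis using False pos(3) by (simp add: norm_L_EB_def)
  qed (simp add: norm_L_EB_def)
  show "rho_EB E B \<le> rho_EB E' B'"
  proof (cases "det (char_mat E' B') = 0")
    case False
    then have pos: "L_EB E' B' > 0" "L_EB E B > 0" "det (char_mat E B) \<noteq> 0" using det L_pos by auto
    have "U_EB E B / L_EB E B \<le> (c * U_EB E' B') / (c * L_EB E' B')"
      using U L pos c by (intro frac_le) (auto simp: U_EB_def)
    also have "\<dots> = U_EB E' B' / L_EB E' B'" using c by simp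
    finally show ?thesis using False pos(3) by (simp add: rho_EB_def)
  qed (simp add: rho_EB_def)
qed

text \<open>The Gram matrix of \<open>B\<close> is block diagonal over the fibres, and the block of
  \<open>\<psi>\<close> is \<open>|K|\<close> times the Gram matrix of the fibre at
  \<open>\<psi>\<close>.\<close>

lemma D_EB_fibers:
  fixes B :: "('h :: {finite, ab_group_add} \<times> 'k :: {finite, ab_group_add} \<Rightarrow> complex) set"
  assumes B: "B \<subseteq> dual" and fib: "\<And>\<psi>. \<psi> \<in> dual \<Longrightarrow> card (fiber B \<psi>) = card E1"
  shows "(D_EB (E1 \<times> UNIV) B)\<^sup>2
    = (\<Prod>\<psi>\<in>dual. real (card (UNIV :: 'k set)) ^ card E1 * (D_EB E1 (fiber B \<psi>))\<^sup>2)"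
proof -
  let ?m = "card (UNIV :: 'k set)" and ?E = "E1 \<times> (UNIV :: 'k set)"
  have "card B = card ?E"
    using card_eq_sum_fibers[OF B] fib by (simp add: card_dual card_cartesian_product mult.commute)
  then have "complex_of_real ((D_EB ?E B)\<^sup>2) = set_det B (gram ?E)"
    using finite_subset_dual[OF B] by (intro D_EB_square) auto
  also have "\<dots> = set_det (\<Union>\<psi>\<in>dual. (\<lambda>\<chi>. char_prod \<chi> \<psi>) ` fiber B \<psi>) (gram ?E)"
    using Union_fibers[OF B] by simp
  also have "\<dots> = (\<Prod>\<psi>\<in>dual. set_det ((\<lambda>\<chi>. char_prod \<chi> \<psi>) ` fiber B \<psi>) (gram ?E))"
    by (rule set_det_UNION)
       (auto simp: finite_dual finite_fiber disjoint_fibers gram_times_UNIV simp del: Int_iff)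
  also have "\<dots> = (\<Prod>\<psi>\<in>dual. complex_of_real (real ?m ^ card E1 * (D_EB E1 (fiber B \<psi>))\<^sup>2))"
  proof (intro prod.cong refl)
    fix \<psi> :: "'k \<Rightarrow> complex" assume psi: "\<psi> \<in> dual"
    have "set_det ((\<lambda>\<chi>. char_prod \<chi> \<psi>) ` fiber B \<psi>) (gram ?E)
        = set_det (fiber B \<psi>) (\<lambda>\<chi> \<chi>'. of_nat ?m * gram E1 \<chi> \<chi>')"
      using psi by (simp add: set_det_image finite_fiber inj_on_char_prod_fiber gram_times_UNIV)
    also have "\<dots> = of_nat ?m ^ card E1 * complex_of_real ((D_EB E1 (fiber B \<psi>))\<^sup>2)"
      unfolding set_det_scale fib[OF psi] using fib[OF psi]
      by (simp only: D_EB_square[OF finite finite_fiber])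
    finally show "set_det ((\<lambda>\<chi>. char_prod \<chi> \<psi>) ` fiber B \<psi>) (gram ?E)
        = complex_of_real (real ?m ^ card E1 * (D_EB E1 (fiber B \<psi>))\<^sup>2)" by simp
  qed
  finally show ?thesis by (simp only: of_real_prod[symmetric] of_real_eq_iff)
qed

lemma D_EB_nonneg [simp]: "0 \<le> D_EB E B"
  by (simp add: D_EB_def)

text \<open>The arithmetic behind the normalization of \<open>D\<close>: the factor
  \<open>sqrt m\<close> produced here cancels against the one in
  \<open>sqrt (n * m)\<close>.\<close>

lemma root_sqrt_power:
  assumes "0 < n" "0 < m" "0 \<le> d"
  shows "root (n * m) (sqrt ((real m ^ n * d\<^sup>2) ^ m)) = sqrt (real m) * root n d"
proof -
  have "sqrt ((real m ^ n * d\<^sup>2) ^ m) = (sqrt (real m) ^ n * d) ^ m"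
    using assms by (simp add: real_sqrt_power real_sqrt_mult)
  also have "\<dots> = (sqrt (real m) * root n d) ^ (n * m)"
    using assms by (simp add: power_mult power_mult_distrib)
  finally show ?thesis using assms by (simp add: real_root_power_cancel)
qed

lemma norm_D_EB_lift_chars:
  fixes E1 :: "'h :: {finite, ab_group_add} set"
    and B :: "('h \<times> 'k :: {finite, ab_group_add} \<Rightarrow> complex) set"
  assumes "B1 \<subseteq> dual" "card B1 = card E1" "E1 \<noteq> {}" and B: "B = lift_chars B1"
  shows "norm_D_EB (E1 \<times> UNIV) B = norm_D_EB E1 B1"
proof -
  let ?m = "card (UNIV :: 'k set)" and ?n = "card E1" and ?E = "E1 \<times> (UNIV :: 'k set)"
  have pos: "?n > 0" "?m > 0" using assms(3) by (simp_all add: card_gt_0_iff)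
  have sub: "B \<subseteq> dual" unfolding B by (rule lift_chars_dual[OF assms(1)])
  have fib: "fiber B \<psi> = B1" if "\<psi> \<in> dual" for \<psi>
    unfolding B by (rule fiber_lift_chars[OF assms(1) that])
  have D2: "(D_EB ?E B)\<^sup>2 = (real ?m ^ ?n * (D_EB E1 B1)\<^sup>2) ^ ?m"
    using D_EB_fibers[OF sub, of E1] assms(2) fib by (simp add: card_dual power_mult_distrib)
  then have "D_EB ?E B = sqrt ((real ?m ^ ?n * (D_EB E1 B1)\<^sup>2) ^ ?m)"
    by (metis D_EB_nonneg real_sqrt_unique)
  then have r: "root (?n * ?m) (D_EB ?E B) = sqrt (real ?m) * root ?n (D_EB E1 B1)"
    using root_sqrt_power[OF pos D_EB_nonneg] by simp
  \<comment> \<open>The two matrices are singular together, so the infinite cases match.\<close>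
  have "(D_EB ?E B)\<^sup>2 = 0 \<longleftrightarrow> (D_EB E1 B1)\<^sup>2 = 0" unfolding D2 using pos by simp
  then have "det (char_mat ?E B) = 0 \<longleftrightarrow> det (char_mat E1 B1) = 0"
    by (simp add: D_EB_def)
  moreover have "sqrt (real (?n * ?m)) / root (?n * ?m) (D_EB ?E B)
      = sqrt (real ?n) / root ?n (D_EB E1 B1)"
    unfolding r using pos by (simp add: real_sqrt_mult)
  ultimately show ?thesis by (simp add: norm_D_EB_def card_cartesian_product)
qed

text \<open>A fibre with more characters than \<open>E1\<close> has points admits a nonzero vector
  of zero energy, and its extension by zero would make \<open>T(E,B)\<close> singular.\<close>

lemma card_fiber_le:
  fixes B :: "('h :: {finite, ab_group_add} \<times> 'k :: {finite, ab_group_add} \<Rightarrow> complex) set"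
  assumes B: "B \<subseteq> dual" "card B = card (E1 \<times> (UNIV :: 'k set))"
    and det: "det (char_mat (E1 \<times> UNIV) B) \<noteq> 0" and psi: "\<psi> \<in> dual"
  shows "card (fiber B \<psi>) \<le> card E1"
proof (rule ccontr)
  assume "\<not> ?thesis"
  then obtain v where v: "coeff_norm (fiber B \<psi>) v \<noteq> 0" "energy E1 (fiber B \<psi>) v = 0"
    using ex_energy_eq_0[OF finite finite_fiber, of E1 B \<psi>] by auto
  obtain w where "coeff_norm B w = coeff_norm (fiber B \<psi>) v"
      "energy (E1 \<times> UNIV) B w = real (card (UNIV :: 'k set)) * energy E1 (fiber B \<psi>) v"
    using extend_coefficients_from_fiber[OF B(1) psi order_refl] by blast
  then have "coeff_norm B w \<noteq> 0 \<and> energy (E1 \<times> UNIV) B w = 0" using v by simp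
  then show False
    using det det_char_mat_eq_0_iff[OF finite finite_subset_dual[OF B(1)] B(2)] by blast
qed

text \<open>All fibres have exactly \<open>card E1\<close> elements, so \<open>D_EB\<close> of
  \<open>B\<close> is controlled by a product over fibres. Replacing each factor by that of the
  fibre with the largest determinant only increases it.\<close>

lemma ex_fiber_norm_D_EB_le:
  fixes E1 :: "'h :: {finite, ab_group_add} set"
    and B :: "('h \<times> 'k :: {finite, ab_group_add} \<Rightarrow> complex) set"
  assumes B: "B \<subseteq> dual" "card B = card (E1 \<times> (UNIV :: 'k set))" and ne: "E1 \<noteq> {}"
    and det: "det (char_mat (E1 \<times> UNIV) B) \<noteq> 0"
  shows "\<exists>B1\<subseteq>dual. card B1 = card E1 \<and> norm_D_EB E1 B1 \<le> norm_D_EB (E1 \<times> UNIV) B"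
proof -
  let ?m = "card (UNIV :: 'k set)" and ?n = "card E1" and ?E = "E1 \<times> (UNIV :: 'k set)"
  let ?K = "dual :: ('k \<Rightarrow> complex) set"
  have pos: "?n > 0" "?m > 0" using ne by (simp_all add: card_gt_0_iff)
  have "(\<Sum>\<psi>\<in>?K. card (fiber B \<psi>)) = (\<Sum>\<psi>\<in>?K. ?n)"
    using card_eq_sum_fibers[OF B(1)] B(2) by (simp add: card_dual card_cartesian_product mult.commute)
  \<comment> \<open>Each fibre has at most \<open>?n\<close> elements and the sizes add up to
    \<open>?m\<close> times \<open>?n\<close>, so equality holds throughout.\<close>
  then have fib: "card (fiber B \<psi>) = ?n" if "\<psi> \<in> ?K" for \<psi>
    using sum_mono_inv[of "\<lambda>\<psi>. card (fiber B \<psi>)" ?K "\<lambda>_. ?n" \<psi>] card_fiber_le[OF B det] that finite_dual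
    by blast
  let ?d = "\<lambda>\<psi>. D_EB E1 (fiber B \<psi>)"
  have "?K \<noteq> {}" using dual_one by blast
  then have "Max (?d ` ?K) \<in> ?d ` ?K" by (intro Max_in) (auto simp: finite_dual)
  then obtain \<psi> where psi: "\<psi> \<in> ?K" "Max (?d ` ?K) = ?d \<psi>" by blast
  have le: "?d \<phi> \<le> ?d \<psi>" if "\<phi> \<in> ?K" for \<phi>
    unfolding psi(2)[symmetric] using that by (intro Max_ge) (auto simp: finite_dual)
  have D2: "(D_EB ?E B)\<^sup>2 \<le> (real ?m ^ ?n * (?d \<psi>)\<^sup>2) ^ ?m"
  proof -
    have "(\<Prod>\<phi>\<in>?K. real ?m ^ ?n * (?d \<phi>)\<^sup>2) \<le> (\<Prod>\<phi>\<in>?K. real ?m ^ ?n * (?d \<psi>)\<^sup>2)"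
      by (intro prod_mono conjI mult_left_mono power_mono le) auto
    then show ?thesis using D_EB_fibers[OF B(1) fib] by (simp add: card_dual)
  qed
  have Dpos: "D_EB ?E B > 0" using det by (simp add: D_EB_def)
  have "D_EB ?E B \<le> sqrt ((real ?m ^ ?n * (?d \<psi>)\<^sup>2) ^ ?m)"
    using D2 by (rule real_le_rsqrt)
  then have "root (?n * ?m) (D_EB ?E B) \<le> root (?n * ?m) (sqrt ((real ?m ^ ?n * (?d \<psi>)\<^sup>2) ^ ?m))"
    using pos by (intro real_root_le_mono) auto
  then have r: "root (?n * ?m) (D_EB ?E B) \<le> sqrt (real ?m) * root ?n (?d \<psi>)"
    by (simp only: root_sqrt_power[OF pos D_EB_nonneg])
  moreover have rpos: "root (?n * ?m) (D_EB ?E B) > 0" using Dpos pos by simp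
  ultimately have prod: "sqrt (real ?m) * root ?n (?d \<psi>) > 0" by linarith
  then have "root ?n (?d \<psi>) > 0" using pos by (simp add: zero_less_mult_iff)
  \<comment> \<open>The best fibre is nonsingular, so both values of \<open>norm_D_EB\<close> are
    finite.\<close>
  then have d: "det (char_mat E1 (fiber B \<psi>)) \<noteq> 0" using pos by (auto simp: D_EB_def)
  have "sqrt (real ?n) / root ?n (?d \<psi>) = sqrt (real (?n * ?m)) / (sqrt (real ?m) * root ?n (?d \<psi>))"
    using pos by (simp add: real_sqrt_mult)
  also have "\<dots> \<le> sqrt (real (?n * ?m)) / root (?n * ?m) (D_EB ?E B)"
    using r rpos prod by (intro divide_left_mono) auto
  finally have "norm_D_EB E1 (fiber B \<psi>) \<le> norm_D_EB ?E B"
    using d det by (simp add: norm_D_EB_def card_cartesian_product)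
  then show ?thesis using fib[OF psi(1)] fiber_subset_dual by blast
qed

section \<open>Minima over character sets, and spectrality\<close>

lemma ex_subset_dual_card:
  fixes E :: "'g :: {finite, ab_group_add} set"
  shows "\<exists>B \<subseteq> (dual :: ('g \<Rightarrow> complex) set). card B = card E"
proof -
  have "card E \<le> card (dual :: ('g \<Rightarrow> complex) set)"
    unfolding card_dual by (intro card_mono) auto
  then show ?thesis by (meson obtain_subset_with_card_n)
qed

lemma finite_dual_quantities:
  fixes E :: "'g :: {finite, ab_group_add} set"
  shows "finite {Q E B | B. B \<subseteq> (dual :: ('g \<Rightarrow> complex) set) \<and> card B = card E}"
  by (rule finite_subset[of _ "Q E ` Pow dual"]) (auto simp: finite_dual)

lemma dual_quantities_nonempty:
  fixes E :: "'g :: {finite, ab_group_add} set"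
  shows "{Q E B | B. B \<subseteq> (dual :: ('g \<Rightarrow> complex) set) \<and> card B = card E} \<noteq> {}"
  using ex_subset_dual_card[of E] by auto

lemma Min_le_MinI:
  fixes A C :: "'a :: linorder set"
  assumes "finite A" "A \<noteq> {}" "finite C" "\<And>a. a \<in> A \<Longrightarrow> \<exists>c\<in>C. c \<le> a"
  shows "Min C \<le> Min A"
proof -
  obtain c where "c \<in> C" "c \<le> Min A" using assms(4)[OF Min_in[OF assms(1,2)]] by blast
  then show ?thesis using Min_le[OF assms(3)] order_trans by blast
qed

text \<open>Both minima range over finite nonempty sets of values, so mutual domination of
  candidates suffices, even across different groups.\<close>

lemma min_over_dual_eqI:
  fixes E :: "'g :: {finite, ab_group_add} set" and E' :: "'h :: {finite, ab_group_add} set"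
  assumes "\<And>B'. B' \<subseteq> dual \<Longrightarrow> card B' = card E' \<Longrightarrow> \<exists>B\<subseteq>dual. card B = card E \<and> Q E B \<le> Q' E' B'"
    and "\<And>B. B \<subseteq> dual \<Longrightarrow> card B = card E \<Longrightarrow> \<exists>B'\<subseteq>dual. card B' = card E' \<and> Q' E' B' \<le> Q E B"
  shows "min_over_dual Q E = min_over_dual Q' E'"
  unfolding min_over_dual_def
proof (rule antisym)
  show "Min {Q E B | B. B \<subseteq> dual \<and> card B = card E} \<le> Min {Q' E' B | B. B \<subseteq> dual \<and> card B = card E'}"
  proof (rule Min_le_MinI[OF finite_dual_quantities dual_quantities_nonempty finite_dual_quantities])
    fix a assume "a \<in> {Q' E' B | B. B \<subseteq> dual \<and> card B = card E'}"
    then show "\<exists>c\<in>{Q E B | B. B \<subseteq> dual \<and> card B = card E}. c \<le> a" using assms(1) by blast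
  qed
  show "Min {Q' E' B | B. B \<subseteq> dual \<and> card B = card E'} \<le> Min {Q E B | B. B \<subseteq> dual \<and> card B = card E}"
  proof (rule Min_le_MinI[OF finite_dual_quantities dual_quantities_nonempty finite_dual_quantities])
    fix a assume "a \<in> {Q E B | B. B \<subseteq> dual \<and> card B = card E}"
    then show "\<exists>c\<in>{Q' E' B | B. B \<subseteq> dual \<and> card B = card E'}. c \<le> a" using assms(2) by blast
  qed
qed

text \<open>Frees spectrality from the enumeration: column positions correspond bijectively to
  characters.\<close>

lemma spectral_iff_gram:
  fixes E :: "'g :: {finite, ab_group_add} set"
  shows "spectral E \<longleftrightarrow> (\<exists>B\<subseteq>dual. card B = card E \<and> (\<forall>b\<in>B. \<forall>b'\<in>B. b \<noteq> b' \<longrightarrow> gram E b b' = 0))"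
proof -
  have "(\<forall>i<card B. \<forall>j<card B. i \<noteq> j \<longrightarrow> col (char_mat E B) i \<bullet>c col (char_mat E B) j = 0) \<longleftrightarrow>
      (\<forall>b\<in>B. \<forall>b'\<in>B. b \<noteq> b' \<longrightarrow> gram E b b' = 0)" if B: "B \<subseteq> dual" for B
  proof -
    let ?e = "\<lambda>i. enumeration B ! i"
    have fin: "finite B" using finite_subset_dual[OF B] .
    note bij = bij_betw_enumeration[OF fin]
    \<comment> \<open>\<open>\<bullet>c\<close> conjugates its second argument and
      \<open>gram\<close> its first, hence the exchanged indices.\<close>
    have col: "col (char_mat E B) i \<bullet>c col (char_mat E B) j = gram E (?e j) (?e i)"
      if "i < card B" "j < card B" for i j
    proof -
      have "col (char_mat E B) i \<bullet>c col (char_mat E B) j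
          = (\<Sum>k<card E. cnj ((?e j) (enumeration E ! k)) * (?e i) (enumeration E ! k))"
        using that by (simp add: scalar_prod_def char_mat_def lessThan_atLeast0 mult.commute)
      also have "\<dots> = gram E (?e j) (?e i)"
        unfolding gram_def
        by (rule sum_enumeration[OF finite, of "\<lambda>x. cnj ((?e j) x) * (?e i) x"])
      finally show ?thesis .
    qed
    have inj: "?e i = ?e j \<longleftrightarrow> i = j" if "i < card B" "j < card B" for i j
      using bij_betw_imp_inj_on[OF bij] that by (auto simp: inj_on_def)
    have img: "B = ?e ` {..<card B}" using bij by (simp add: bij_betw_def)
    have "(\<forall>b\<in>B. \<forall>b'\<in>B. b \<noteq> b' \<longrightarrow> gram E b b' = 0) \<longleftrightarrow>
        (\<forall>j<card B. \<forall>i<card B. ?e j \<noteq> ?e i \<longrightarrow> gram E (?e j) (?e i) = 0)"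
      by (subst (1 2) img) auto
    then show ?thesis using col inj by metis
  qed
  then show ?thesis unfolding spectral_def by (intro ex_cong1 conj_cong refl) blast
qed

text \<open>Upwards, the lifted set is orthogonal because its Gram matrix is block diagonal with
  multiples of the Gram matrix of \<open>B1\<close> as blocks. Downwards, any \<open>card E1\<close>
  characters from one large fibre inherit orthogonality.\<close>

lemma spectral_times_UNIV:
  fixes E1 :: "'h :: {finite, ab_group_add} set"
  shows "spectral E1 \<longleftrightarrow> spectral (E1 \<times> (UNIV :: 'k :: {finite, ab_group_add} set))"
proof
  let ?E = "E1 \<times> (UNIV :: 'k set)"
  assume "spectral E1"
  then obtain B1 where B1: "B1 \<subseteq> dual" "card B1 = card E1"
      "\<And>b b'. b \<in> B1 \<Longrightarrow> b' \<in> B1 \<Longrightarrow> b \<noteq> b' \<Longrightarrow> gram E1 b b' = 0"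
    unfolding spectral_iff_gram by blast
  define B :: "('h \<times> 'k \<Rightarrow> complex) set" where "B = lift_chars B1"
  have "gram ?E b b' = 0" if bb: "b \<in> B" "b' \<in> B" "b \<noteq> b'" for b b'
  proof -
    obtain \<chi> \<psi> where b: "\<chi> \<in> B1" "\<psi> \<in> dual" "b = char_prod \<chi> \<psi>"
      using bb(1) unfolding B_def mem_lift_chars by blast
    obtain \<chi>' \<psi>' where b': "\<chi>' \<in> B1" "\<psi>' \<in> dual" "b' = char_prod \<chi>' \<psi>'"
      using bb(2) unfolding B_def mem_lift_chars by blast
    show ?thesis using bb(3) b b' B1(3)[of \<chi> \<chi>'] by (auto simp: gram_times_UNIV)
  qed
  moreover have "card B = card ?E"
    unfolding B_def by (simp add: card_lift_chars[OF B1(1)] B1(2) card_cartesian_product)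
  moreover have "B \<subseteq> dual" unfolding B_def by (rule lift_chars_dual[OF B1(1)])
  ultimately show "spectral ?E" unfolding spectral_iff_gram by blast
next
  let ?E = "E1 \<times> (UNIV :: 'k set)"
  assume "spectral ?E"
  then obtain B where B: "B \<subseteq> dual" "card B = card ?E"
      "\<And>b b'. b \<in> B \<Longrightarrow> b' \<in> B \<Longrightarrow> b \<noteq> b' \<Longrightarrow> gram ?E b b' = 0"
    unfolding spectral_iff_gram by blast
  obtain \<psi> B' where psi: "\<psi> \<in> dual" and B': "B' \<subseteq> fiber B \<psi>" "card B' = card E1"
    using ex_large_fiber[OF B(1), of "card E1"] B(2) by (auto simp: card_cartesian_product)
  have "gram E1 \<chi> \<chi>' = 0" if "\<chi> \<in> B'" "\<chi>' \<in> B'" "\<chi> \<noteq> \<chi>'" for \<chi> \<chi>'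
  proof -
    have "\<chi> \<in> dual" "\<chi>' \<in> dual" "char_prod \<chi> \<psi> \<in> B" "char_prod \<chi>' \<psi> \<in> B"
      using that B'(1) by (auto simp: fiber_def)
    then have "gram ?E (char_prod \<chi> \<psi>) (char_prod \<chi>' \<psi>) = 0"
      using B(3) that(3) psi by (simp add: char_prod_inj)
    then show ?thesis by (simp add: gram_times_UNIV[OF psi psi])
  qed
  moreover have "B' \<subseteq> dual" using B'(1) fiber_subset_dual by blast
  ultimately show "spectral E1" unfolding spectral_iff_gram using B'(2) by blast
qed

theorem theorem6p17:
  fixes E1 :: "'h :: {finite, ab_group_add} set"
    and E :: "('h \<times> 'k :: {finite, ab_group_add}) set"
  assumes "E1 \<noteq> {}"
    and "E = E1 \<times> (UNIV :: 'k set)"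
  shows "norm_L E = norm_L E1 \<and> norm_U E = norm_U E1 \<and>
         norm_rho E = norm_rho E1 \<and> norm_D E = norm_D E1 \<and>
         rho (E1 \<times> (UNIV :: 'k set)) = rho E1 \<and>
         (spectral E1 \<longleftrightarrow> spectral (E1 \<times> (UNIV :: 'k set)))"
proof -
  let ?m = "card (UNIV :: 'k set)"
  have m: "?m > 0" by (simp add: card_gt_0_iff)
  have n: "card E1 > 0" using assms(1) by (simp add: card_gt_0_iff)
  have E: "E = E1 \<times> (UNIV :: 'k set)" "card E = card E1 * ?m"
    using assms(2) by (simp_all add: card_cartesian_product)
  \<comment> \<open>The lift of \<open>B1\<close> is a candidate for \<open>E\<close> that does at
    least as well in all four quantities.\<close>
  have up: "lift_chars B1 \<subseteq> (dual :: ('h \<times> 'k \<Rightarrow> complex) set)"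
      "card (lift_chars B1 :: ('h \<times> 'k \<Rightarrow> complex) set) = card E"
      "norm_L_EB E (lift_chars B1) \<le> norm_L_EB E1 B1" "norm_U_EB E (lift_chars B1) \<le> norm_U_EB E1 B1"
      "rho_EB E (lift_chars B1) \<le> rho_EB E1 B1" "norm_D_EB E (lift_chars B1) \<le> norm_D_EB E1 B1"
    if B1: "B1 \<subseteq> dual" "card B1 = card E1" for B1
  proof -
    let ?B = "lift_chars B1 :: ('h \<times> 'k \<Rightarrow> complex) set"
    show sub: "?B \<subseteq> dual" by (rule lift_chars_dual[OF B1(1)])
    show card: "card ?B = card E" using E(2) B1 by (simp add: card_lift_chars)
    have ne: "B1 \<noteq> {}" using n B1(2) by auto
    show "norm_L_EB E ?B \<le> norm_L_EB E1 B1" "norm_U_EB E ?B \<le> norm_U_EB E1 B1"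
        "rho_EB E ?B \<le> rho_EB E1 B1"
      using norm_quantities_mono[OF finite finite_subset_dual[OF sub] finite finite_subset_dual[OF B1(1)]
          assms(1) _ _ card B1(2), of "real ?m"] m E(2)
        L_U_lift_chars[OF B1(1) ne refl, of E1, where 'k = 'k] E(1)
      by (auto simp: mult.commute)
    show "norm_D_EB E ?B \<le> norm_D_EB E1 B1"
      using norm_D_EB_lift_chars[OF B1 assms(1) refl, where 'k = 'k] E(1) by simp
  qed
  \<comment> \<open>One subset of a large fibre serves three quantities at once; \<open>D\<close>
    needs a different fibre and is treated separately.\<close>
  have down: "\<exists>B1\<subseteq>dual. card B1 = card E1 \<and> norm_L_EB E1 B1 \<le> norm_L_EB E B \<and>
      norm_U_EB E1 B1 \<le> norm_U_EB E B \<and> rho_EB E1 B1 \<le> rho_EB E B"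
    if B: "B \<subseteq> dual" "card B = card E" for B
  proof -
    obtain \<psi> B' where psi: "\<psi> \<in> dual" and B': "B' \<subseteq> fiber B \<psi>" "card B' = card E1"
      using ex_large_fiber[OF B(1), of "card E1"] B(2) E(2) by auto
    have sub: "B' \<subseteq> dual" using B'(1) fiber_subset_dual by blast
    have ne: "B' \<noteq> {}" using n B'(2) by auto
    have LU: "L_EB E B \<le> real ?m * L_EB E1 B'" "real ?m * U_EB E1 B' \<le> U_EB E B"
      unfolding E(1) by (rule L_U_fiber[OF B(1) psi B'(1) ne])+
    have E_ne: "E \<noteq> {}" using E(1) assms(1) by simp
    \<comment> \<open>The comparison with the roles of \<open>E\<close> and \<open>E1\<close>
      exchanged, hence the ratio \<open>1 / real ?m\<close>.\<close>
    have "1 / real ?m * L_EB E B \<le> L_EB E1 B'" "U_EB E1 B' \<le> 1 / real ?m * U_EB E B"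
        "real (card E1) = 1 / real ?m * real (card E)" "1 / real ?m > 0"
      using LU E(2) m by (auto simp: field_simps)
    from norm_quantities_mono[OF finite finite_subset_dual[OF sub] finite finite_subset_dual[OF B(1)]
        E_ne this(4,3) B'(2) B(2) this(1,2)]
    show ?thesis using sub B'(2) by blast
  qed
  have "norm_L E = norm_L E1"
    unfolding norm_L_def by (rule min_over_dual_eqI) (meson up(1,2,3), meson down)
  moreover have "norm_U E = norm_U E1"
    unfolding norm_U_def by (rule min_over_dual_eqI) (meson up(1,2,4), meson down)
  moreover have rho: "rho E = rho E1"
    unfolding rho_def by (rule min_over_dual_eqI) (meson up(1,2,5), meson down)
  moreover have "norm_rho E = norm_rho E1"
    using rho by (simp add: norm_rho_def rho_def norm_rho_EB_def[abs_def])
  moreover have "norm_D E = norm_D E1"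
    unfolding norm_D_def
  proof (rule min_over_dual_eqI)
    fix B :: "('h \<times> 'k \<Rightarrow> complex) set" assume B: "B \<subseteq> dual" "card B = card E"
    show "\<exists>B1\<subseteq>dual. card B1 = card E1 \<and> norm_D_EB E1 B1 \<le> norm_D_EB E B"
    proof (cases "det (char_mat E B) = 0")
      \<comment> \<open>A singular \<open>T(E,B)\<close> has the value \<open>\<infinity>\<close>,
        so any \<open>B1\<close> of the right size will do.\<close>
      case True
      then show ?thesis using ex_subset_dual_card[of E1] by (auto simp: norm_D_EB_def)
    next
      case False
      then show ?thesis using ex_fiber_norm_D_EB_le[of B E1] B assms(1) unfolding E(1) by blast
    qed
  qed (meson up(1,2,6))
  ultimately show ?thesis using spectral_times_UNIV[of E1, where 'k = 'k] E(1) by simp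
qed

end
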